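(* Let $\mathcal{U}_{3,3,2}$ be the upper cluster algebra of the seed $((x_1,x_2,x_3),B)$ with no frozen variables, where $$B=\begin{bmatrix}0&-3&2\\3&0&-3\\-2&3&0\end{bmatrix}.$$ Then $\mathcal{U}_{3,3,2}$ is generated over $\mathbb{Z}$ by $x_1,x_2,x_3$ and $$y_0=\frac{x_2^3+x_1^2+x_3^2}{x_1x_3},\qquad y_1=\frac{x_1x_2^3+x_2^3x_3+x_1^3+x_3^3}{x_1x_2x_3},$$ $$y_2=\frac{x_2^6+2x_1^2x_2^3+x_1x_2^3x_3+2x_2^3x_3^2+x_1^4+x_1^3x_3+x_1x_3^3+x_3^4}{x_1^2x_2x_3^2},$$ $$y_3=\frac{x_2^{9}+3x_1^2x_2^6+3x_2^6x_3^2+3x_1^4x_2^3+3x_1^2x_2^3x_3^2+3x_2^3x_3^4+x_1^6+2x_1^3x_3^3+x_3^6}{x_1^3x_2^2x_3^3}.$$ The ideal of relations among these generators is generated by the elements $$y_2^2=y_0y_3+2y_3,\qquad y_0^2=x_2y_2-y_0+2,$$ $$y_1y_2=x_1y_3+x_3y_3,\qquad y_0y_2=x_2y_3+y_2,$$ $$y_0y_1=x_1y_2+x_3y_2-2y_1,\qquad x_1y_0+x_3y_0=x_2y_1+x_1+x_3,$$ $$x_2^2y_2=x_1x_3y_3+3x_2y_0-y_1^2-3x_2,\qquad x_2^2y_0=x_1x_3y_2+x_2^2-x_1y_1-x_3y_1,$$ $$x_2^3+x_3^2y_0=x_2x_3y_1-x_1^2+x_1x_3.$$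
   Context: A seed with $n=m=3$ (three mutable variables, no frozen variables) is a pair $(\mathbf{x},B)$ where $\mathbf{x}=(x_1,x_2,x_3)$ freely generates the field $\mathcal{F}=\mathbb{Q}(x_1,x_2,x_3)$ over $\mathbb{Q}$ and $B$ is a $3\times3$ skew-symmetric integer matrix. For $1\le k\le 3$ the mutation of $(\mathbf{x},B)$ at $k$ is the seed $(\mathbf{x}',B')$ with $x_i'=x_i$ for $i\neq k$, $x_k'=\left(\prod_{B_{jk}>0}x_j^{B_{jk}}+\prod_{B_{jk}<0}x_j^{-B_{jk}}\right)x_k^{-1}$, and $B'_{ij}=-B_{ij}$ if $i=k$ or $j=k$, $B'_{ij}=B_{ij}+\frac{|B_{ik}|B_{kj}+B_{ik}|B_{kj}|}{2}$ otherwise. Mutation-equivalence is the equivalence relation generated by mutations and simultaneous permutations of indices. The clusters are the sets $\{z_1,z_2,z_3\}$ of variables of seeds mutation-equivalent to the initial seed. The upper cluster algebra is $\mathcal{U}=\bigcap_{\text{clusters }\{z_1,z_2,z_3\}}\mathbb{Z}[z_1^{\pm1},z_2^{\pm1},z_3^{\pm1}]\subset\mathcal{F}$. The ideal of relations is the kernel of the surjection onto $\mathcal{U}$ from the polynomial ring over $\mathbb{Z}$ on symbols for the listed generators; an equation $P=Q$ stands for the element $P-Q$. *)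

theory Defs
  imports "HOL-Analysis.Analysis" "HOL-Library.Poly_Mapping"
begin

definition is_subring :: "'a::comm_ring_1 set \<Rightarrow> bool" where
  "is_subring R \<longleftrightarrow> 1 \<in> R \<and> (\<forall>a\<in>R. \<forall>b\<in>R. a - b \<in> R \<and> a * b \<in> R)"

definition is_ideal :: "'a::comm_ring_1 set \<Rightarrow> bool" where
  "is_ideal I \<longleftrightarrow> 0 \<in> I \<and> (\<forall>a\<in>I. \<forall>b\<in>I. a + b \<in> I) \<and> (\<forall>r. \<forall>a\<in>I. r * a \<in> I)"

(* Polynomials in variables of type 'v: finitely supported maps from exponent vectors
   (themselves finitely supported maps from variables to nat) to coefficients. *)
type_synonym ('v, 'c) mpol = "('v \<Rightarrow>\<^sub>0 nat) \<Rightarrow>\<^sub>0 'c"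

definition mvar :: "'v \<Rightarrow> ('v, 'c::comm_ring_1) mpol" where
  "mvar v = Poly_Mapping.single (Poly_Mapping.single v 1) 1"

(* The homomorphism that acts on coefficients by c and sends the variable v to f v. *)
definition mpol_eval ::
    "('c \<Rightarrow> 'a) \<Rightarrow> ('v \<Rightarrow> 'a) \<Rightarrow> ('v, 'c::zero) mpol \<Rightarrow> 'a::comm_ring_1" where
  "mpol_eval c f p =
     (\<Sum>m \<in> Poly_Mapping.keys p. c (Poly_Mapping.lookup p m) *
        (\<Prod>v \<in> Poly_Mapping.keys m. f v ^ Poly_Mapping.lookup m v))"

(* The ambient field is the whole type 'a. The components of x freely generate it over the
   rationals if they are algebraically independent and every element of 'a is a rational
   function of them. *)
definition freely_generates :: "'a::field_char_0 ^ 3 \<Rightarrow> bool" where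
  "freely_generates x \<longleftrightarrow>
     (\<forall>p. mpol_eval of_rat (($) x) p = 0 \<longrightarrow> p = 0) \<and>
     (\<forall>a. \<exists>p q. mpol_eval of_rat (($) x) q \<noteq> 0 \<and>
        a = mpol_eval of_rat (($) x) p / mpol_eval of_rat (($) x) q)"

type_synonym 'a seed = "('a ^ 3) \<times> (int ^ 3 ^ 3)"

definition is_seed :: "'a::field_char_0 seed \<Rightarrow> bool" where
  "is_seed s \<longleftrightarrow> freely_generates (fst s) \<and> transpose (snd s) = - snd s"

definition mutate_vars :: "3 \<Rightarrow> 'a::field_char_0 seed \<Rightarrow> 'a ^ 3" where
  "mutate_vars k s = (let x = fst s; B = snd s in
     \<chi> i. if i = k
         then ((\<Prod>j | B $ j $ k > 0. (x $ j) ^ nat (B $ j $ k)) +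
               (\<Prod>j | B $ j $ k < 0. (x $ j) ^ nat (- (B $ j $ k)))) * inverse (x $ k)
         else x $ i)"

(* The division by 2 is exact. *)
definition mutate_matrix :: "3 \<Rightarrow> int ^ 3 ^ 3 \<Rightarrow> int ^ 3 ^ 3" where
  "mutate_matrix k B =
     (\<chi> i j. if i = k \<or> j = k then - (B $ i $ j)
        else B $ i $ j + (\<bar>B $ i $ k\<bar> * B $ k $ j + B $ i $ k * \<bar>B $ k $ j\<bar>) div 2)"

definition mutate :: "3 \<Rightarrow> 'a::field_char_0 seed \<Rightarrow> 'a seed" where
  "mutate k s = (mutate_vars k s, mutate_matrix k (snd s))"

definition permute_seed :: "(3 \<Rightarrow> 3) \<Rightarrow> 'a seed \<Rightarrow> 'a seed" where
  "permute_seed \<pi> s = (\<chi> i. fst s $ \<pi> i, \<chi> i j. snd s $ \<pi> i $ \<pi> j)"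

inductive seed_step :: "'a::field_char_0 seed \<Rightarrow> 'a seed \<Rightarrow> bool" where
  "is_seed s \<Longrightarrow> seed_step s (mutate k s)"
| "is_seed s \<Longrightarrow> bij \<pi> \<Longrightarrow> seed_step s (permute_seed \<pi> s)"

definition mutation_equivalent :: "'a::field_char_0 seed \<Rightarrow> 'a seed \<Rightarrow> bool" where
  "mutation_equivalent = equivclp seed_step"

definition clusters :: "'a::field_char_0 seed \<Rightarrow> 'a set set" where
  "clusters s = {range (($) z) | z C. mutation_equivalent s (z, C)}"

definition laurent_ring :: "'a::field_char_0 set \<Rightarrow> 'a set" where
  "laurent_ring Z = is_subring hull (Z \<union> inverse ` Z)"

definition upper_cluster_algebra :: "'a::field_char_0 seed \<Rightarrow> 'a set" where
  "upper_cluster_algebra s = (\<Inter>Z \<in> clusters s. laurent_ring Z)"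

definition B332 :: "int ^ 3 ^ 3" where
  "B332 = vector [vector [ 0, -3,  2],
                  vector [ 3,  0, -3],
                  vector [-2,  3,  0]]"

datatype gensym = X1 | X2 | X3 | Y0 | Y1 | Y2 | Y3

fun gen332 :: "'a::field_char_0 ^ 3 \<Rightarrow> gensym \<Rightarrow> 'a" where
  "gen332 x X1 = x $ 1"
| "gen332 x X2 = x $ 2"
| "gen332 x X3 = x $ 3"
| "gen332 x Y0 = (let x1 = x $ 1; x2 = x $ 2; x3 = x $ 3 in
     (x2^3 + x1^2 + x3^2) / (x1 * x3))"
| "gen332 x Y1 = (let x1 = x $ 1; x2 = x $ 2; x3 = x $ 3 in
     (x1 * x2^3 + x2^3 * x3 + x1^3 + x3^3) / (x1 * x2 * x3))"
| "gen332 x Y2 = (let x1 = x $ 1; x2 = x $ 2; x3 = x $ 3 in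
     (x2^6 + 2 * x1^2 * x2^3 + x1 * x2^3 * x3 + 2 * x2^3 * x3^2
        + x1^4 + x1^3 * x3 + x1 * x3^3 + x3^4) / (x1^2 * x2 * x3^2))"
| "gen332 x Y3 = (let x1 = x $ 1; x2 = x $ 2; x3 = x $ 3 in
     (x2^9 + 3 * x1^2 * x2^6 + 3 * x2^6 * x3^2 + 3 * x1^4 * x2^3 + 3 * x1^2 * x2^3 * x3^2
        + 3 * x2^3 * x3^4 + x1^6 + 2 * x1^3 * x3^3 + x3^6) / (x1^3 * x2^2 * x3^3))"

definition relations332 :: "(gensym, int) mpol set" where
  "relations332 = (let
       x1 = mvar X1; x2 = mvar X2; x3 = mvar X3;
       y0 = mvar Y0; y1 = mvar Y1; y2 = mvar Y2; y3 = mvar Y3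
     in {
       y2^2 - (y0 * y3 + 2 * y3),
       y0^2 - (x2 * y2 - y0 + 2),
       y1 * y2 - (x1 * y3 + x3 * y3),
       y0 * y2 - (x2 * y3 + y2),
       y0 * y1 - (x1 * y2 + x3 * y2 - 2 * y1),
       (x1 * y0 + x3 * y0) - (x2 * y1 + x1 + x3),
       x2^2 * y2 - (x1 * x3 * y3 + 3 * x2 * y0 - y1^2 - 3 * x2),
       x2^2 * y0 - (x1 * x3 * y2 + x2^2 - x1 * y1 - x3 * y1),
       (x2^3 + x3^2 * y0) - (x2 * x3 * y1 - x1^2 + x1 * x3)})"

end

(* Write z = y0 - 1. Then x1 x3 z = x2^3 + x1^2 + x3^2 - x1 x3, x2 y1 = (x1 + x3) z, x2 y2 = z (z + 3)
   and x2^2 y3 = z^2 (z + 3).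

   The generators lie in every cluster's Laurent ring: along any mutation sequence the exchange matrix
   stays cyclic with entries a, b, c of absolute value at least 2 (a^2 + b^2 + c^2 - a b c = 4 is
   preserved), and then lying in the Laurent rings of a seed and of its three neighbours passes from a
   seed to its neighbours.

   Conversely, an element of the Laurent rings of the initial seed and of its mutation at 2 is, up to a
   power of x1 x3, a polynomial in x1, x3, x2, x2'. The denominators are then removed one at a time.
   Modulo the relations, the polynomial ring is spanned over Z[x1, x3, y3] by 1, x2, x2^2, z, x2 z, y2,
   x2 y2, x2^2 y2, y1. Sending (x1', x2, x3) to (t^3 (w + 1), -t^2, t^3) kills x1 and sends z to w, and the
   images of the nine elements stay independent over Z[x3, y3]: expand in powers of w^2 (w + 3), then
   compare the exponents of t modulo 3. Hence x1 g in the ring generated, with g in the Laurent ring of the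
   mutation at 1, forces g into that ring; the same independence makes every relation a consequence of
   the nine listed. *)

theory Submission
  imports Defs "HOL-Computational_Algebra.Polynomial"
begin

text \<open>Why nine elements: as a rational function of x2 over Q(x1, x3), y3 has numerator of
  degree 9, nonzero at x2 = 0, and denominator of degree 2. So the whole field has degree 9 over
  Q(x1, x3, y3). The shift z = y0 - 1 makes every relation a rewriting rule for a product of two or
  three of the symbols x2, z, y1, y2; the spanning elements are the monomials that no rule touches.
  The obstacle to setting x1 = 0 is that no homomorphism out of a field kills x1. Substitution is
  therefore a relation between field elements and values, and membership in the Laurent ring of the
  mutation at 1 is what guarantees that g has a value where x1 becomes 0. Without a value for g, the
  equation "combination = x1 g" would say nothing about the combination. The constant 4 in the
  invariant comes from the weights 3, 2, 3. It keeps all weights at least 2, and an exponent of at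
  least 2 is what makes the relevant elements comaximal when a neighbouring seed is reached.\<close>

section \<open>Subrings, Laurent rings and ideals\<close>

lemma is_subringD:
  assumes "is_subring R"
  shows "1 \<in> R" "0 \<in> R" "a \<in> R \<Longrightarrow> b \<in> R \<Longrightarrow> a - b \<in> R" "a \<in> R \<Longrightarrow> b \<in> R \<Longrightarrow> a * b \<in> R"
    "a \<in> R \<Longrightarrow> - a \<in> R" "a \<in> R \<Longrightarrow> b \<in> R \<Longrightarrow> a + b \<in> R" "a \<in> R \<Longrightarrow> a ^ n \<in> R"
    "of_int k \<in> R" "of_nat n \<in> R" "numeral w \<in> R"
proof -
  show 1: "1 \<in> R" and d: "\<And>a b. a \<in> R \<Longrightarrow> b \<in> R \<Longrightarrow> a - b \<in> R"
    and m: "\<And>a b. a \<in> R \<Longrightarrow> b \<in> R \<Longrightarrow> a * b \<in> R"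
    using assms by (auto simp: is_subring_def)
  show 0: "0 \<in> R"
    using d[OF 1 1] by simp
  show u: "- a \<in> R" if "a \<in> R" for a
    using d[OF 0 that] by simp
  show p: "a + b \<in> R" if "a \<in> R" "b \<in> R" for a b
    using d[OF that(1) u[OF that(2)]] by simp
  show "a ^ n \<in> R" if "a \<in> R" for a
    by (induction n) (use 1 m that in auto)
  show n: "of_nat n \<in> R" for n
    by (induction n) (use 0 1 p in auto)
  show "of_int k \<in> R"
    by (cases k) (use n u[OF n] in \<open>auto simp flip: of_nat_Suc\<close>)
  show "numeral w \<in> R"
    using n[of "numeral w"] by simp
qed

lemma is_subring_hull: "is_subring (is_subring hull S)"
  by (rule hull_in) (auto simp: is_subring_def)

lemmas subring_hull_closed = is_subringD[OF is_subring_hull]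

lemma subring_hull_subset: "is_subring R \<Longrightarrow> S \<subseteq> R \<Longrightarrow> is_subring hull S \<subseteq> R"
  by (rule hull_minimal)

lemma is_subring_laurent_ring: "is_subring (laurent_ring Z)"
  unfolding laurent_ring_def by (rule is_subring_hull)

lemmas laurent_ring_closed = is_subringD[OF is_subring_laurent_ring]

lemma laurent_ring_base:
  "z \<in> Z \<Longrightarrow> z \<in> laurent_ring Z" "z \<in> Z \<Longrightarrow> inverse z \<in> laurent_ring Z"
  unfolding laurent_ring_def by (auto intro!: hull_inc)

lemma laurent_ring_subset:
  "is_subring R \<Longrightarrow> Z \<subseteq> R \<Longrightarrow> inverse ` Z \<subseteq> R \<Longrightarrow> laurent_ring Z \<subseteq> R"
  unfolding laurent_ring_def by (rule subring_hull_subset) auto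

lemma is_idealD:
  assumes "is_ideal I"
  shows "0 \<in> I" "a \<in> I \<Longrightarrow> b \<in> I \<Longrightarrow> a + b \<in> I" "a \<in> I \<Longrightarrow> r * a \<in> I"
    "a \<in> I \<Longrightarrow> a * r \<in> I" "a \<in> I \<Longrightarrow> - a \<in> I" "a \<in> I \<Longrightarrow> b \<in> I \<Longrightarrow> a - b \<in> I"
proof -
  show 0: "0 \<in> I" and p: "\<And>a b. a \<in> I \<Longrightarrow> b \<in> I \<Longrightarrow> a + b \<in> I"
    and m: "\<And>r a. a \<in> I \<Longrightarrow> r * a \<in> I"
    using assms by (auto simp: is_ideal_def)
  show "a * r \<in> I" if "a \<in> I" for a r
    using m[OF that, of r] by (simp add: mult.commute)
  show u: "- a \<in> I" if "a \<in> I" for a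
    using m[OF that, of "-1"] by simp
  show "a - b \<in> I" if "a \<in> I" "b \<in> I" for a b
    using p[OF that(1) u[OF that(2)]] by simp
qed

lemma is_ideal_hull: "is_ideal (is_ideal hull S)"
  by (rule hull_in) (auto simp: is_ideal_def)

section \<open>Polynomials and their evaluation\<close>

lemma poly_mapping_single_induct [case_names zero add]:
  assumes "P 0"
    and "\<And>f k v. P f \<Longrightarrow> k \<notin> Poly_Mapping.keys f \<Longrightarrow> v \<noteq> 0 \<Longrightarrow> P (f + Poly_Mapping.single k v)"
  shows "P (f :: 'k \<Rightarrow>\<^sub>0 'b::comm_monoid_add)"
proof (induction f rule: Poly_Mapping.update_induct)
  case const
  show ?case using assms(1) by simp
next
  case (update f a b)
  have "Poly_Mapping.update a b f = f + Poly_Mapping.single a b"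
    using update(1)
    by (intro poly_mapping_eqI) (auto simp: lookup_update lookup_add lookup_single when_def in_keys_iff)
  then show ?case
    using assms(2)[OF update(3,1,2)] by simp
qed

locale coeff_hom =
  fixes c :: "'c::comm_ring_1 \<Rightarrow> 'a::comm_ring_1"
  assumes c_add: "c (a + b) = c a + c b" and c_mult: "c (a * b) = c a * c b" and c_1: "c 1 = 1"
begin

lemma c_0: "c 0 = 0"
  using c_add[of 0 0] by simp

definition mon :: "('v \<Rightarrow> 'a) \<Rightarrow> ('v \<Rightarrow>\<^sub>0 nat) \<Rightarrow> 'a" where
  "mon f m = (\<Prod>v \<in> Poly_Mapping.keys m. f v ^ Poly_Mapping.lookup m v)"

lemma mon_superset:
  "finite A \<Longrightarrow> Poly_Mapping.keys m \<subseteq> A \<Longrightarrow> mon f m = (\<Prod>v \<in> A. f v ^ Poly_Mapping.lookup m v)"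
  unfolding mon_def by (rule prod.mono_neutral_left) (auto simp: in_keys_iff)

lemma mon_add: "mon f (m + n) = mon f m * mon f n"
proof -
  let ?A = "Poly_Mapping.keys m \<union> Poly_Mapping.keys n"
  have "Poly_Mapping.keys (m + n) \<subseteq> ?A"
    by (rule Poly_Mapping.keys_add)
  then show ?thesis
    by (simp add: mon_superset[of ?A] lookup_add power_add prod.distrib)
qed

lemma mpol_eval_add: "mpol_eval c f (p + q) = mpol_eval c f p + mpol_eval c f q"
  unfolding mpol_eval_def
  by (rule setsum_keys_plus_distrib) (auto simp: c_0 c_add algebra_simps)

lemma mpol_eval_zero: "mpol_eval c f 0 = 0"
  by (simp add: mpol_eval_def)

lemma mpol_eval_single: "mpol_eval c f (Poly_Mapping.single m a) = c a * mon f m"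
  by (cases "a = 0") (auto simp: mpol_eval_def mon_def c_0)

lemma mpol_eval_mult: "mpol_eval c f (p * q) = mpol_eval c f p * mpol_eval c f q"
proof (induction p rule: poly_mapping_single_induct)
  case zero
  then show ?case by (simp add: mpol_eval_zero)
next
  case (add p k v)
  have "mpol_eval c f (Poly_Mapping.single k v * q) = c v * mon f k * mpol_eval c f q"
    by (induction q rule: poly_mapping_single_induct)
      (simp_all add: mpol_eval_zero mpol_eval_add mpol_eval_single distrib_left mult_single
        c_mult mon_add algebra_simps)
  with add show ?case
    by (simp add: distrib_right mpol_eval_add mpol_eval_single)
qed

lemma mpol_eval_one: "mpol_eval c f 1 = 1"
  using mpol_eval_single[of f 0 1] by (simp add: c_1 mon_def)

lemma mpol_eval_uminus: "mpol_eval c f (- p) = - mpol_eval c f p"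
  using mpol_eval_add[of f p "-p"] by (simp add: mpol_eval_zero eq_neg_iff_add_eq_0 add.commute)

lemma mpol_eval_diff: "mpol_eval c f (p - q) = mpol_eval c f p - mpol_eval c f q"
  using mpol_eval_add[of f p "-q"] by (simp add: mpol_eval_uminus)

lemma mpol_eval_mvar: "mpol_eval c f (mvar v) = f v"
  by (simp add: mvar_def mpol_eval_single mon_def c_1)

lemma mpol_eval_power: "mpol_eval c f (p ^ n) = mpol_eval c f p ^ n"
  by (induction n) (auto simp: mpol_eval_one mpol_eval_mult)

lemma mpol_eval_of_nat: "mpol_eval c f (of_nat n) = of_nat n"
  by (induction n) (auto simp: mpol_eval_zero mpol_eval_add mpol_eval_one)

lemma mpol_eval_numeral: "mpol_eval c f (numeral w) = numeral w"
  using mpol_eval_of_nat[of f "numeral w"] by simp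

lemma mpol_eval_of_int: "mpol_eval c f (of_int k) = of_int k"
  by (cases k rule: int_cases2) (simp_all add: mpol_eval_of_nat mpol_eval_uminus)

lemmas mpol_eval_simps = mpol_eval_add mpol_eval_zero mpol_eval_mult mpol_eval_one mpol_eval_uminus
  mpol_eval_diff mpol_eval_mvar mpol_eval_power mpol_eval_numeral mpol_eval_of_int

end

interpretation of_int_coeff: coeff_hom "of_int :: int \<Rightarrow> 'a::comm_ring_1"
  by unfold_locales auto

lemma single_in_subring:
  assumes R: "is_subring R" and v: "\<And>v. mvar v \<in> R"
  shows "Poly_Mapping.single m (a::int) \<in> (R :: ('v, int) mpol set)"
proof -
  have "Poly_Mapping.single m (1::int) \<in> R"
  proof (induction m rule: poly_mapping_single_induct)
    case zero
    then show ?case using is_subringD(1)[OF R] by simp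
  next
    case (add m k n)
    have "Poly_Mapping.single (Poly_Mapping.single k n) (1::int) = mvar k ^ n"
    proof (induction n)
      case (Suc n)
      have "mvar k ^ Suc n = mvar k * Poly_Mapping.single (Poly_Mapping.single k n) (1::int)"
        by (simp add: Suc)
      also have "\<dots> = Poly_Mapping.single (Poly_Mapping.single k 1 + Poly_Mapping.single k n) 1"
        by (simp only: mvar_def mult_single mult_1)
      finally show ?case
        by (simp flip: single_add)
    qed simp
    then have "Poly_Mapping.single (m + Poly_Mapping.single k n) (1::int)
        = Poly_Mapping.single m 1 * mvar k ^ n"
      by (metis mult_1 mult_single)
    then show ?case
      using add v is_subringD[OF R] by simp
  qed
  moreover have "Poly_Mapping.single m a = of_int a * Poly_Mapping.single m 1"
  proof -
    have "of_int a = Poly_Mapping.single (0::'v \<Rightarrow>\<^sub>0 nat) a"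
      by (cases a rule: int_cases2) (simp_all add: single_uminus flip: single_of_nat)
    then show ?thesis by (simp add: mult_single)
  qed
  ultimately show ?thesis
    using is_subringD[OF R] by simp
qed

text \<open>Serves as an induction principle for integer polynomials: with \<open>R\<close> the set
  of polynomials having some property, only closure under the ring operations and the variables have
  to be checked. Integer constants come for free, as they lie in every subring.\<close>

lemma mpol_in_subring:
  assumes R: "is_subring R" and v: "\<And>v. mvar v \<in> R"
  shows "(p :: ('v, int) mpol) \<in> R"
proof (induction p rule: poly_mapping_single_induct)
  case zero
  show ?case by (rule is_subringD(2)[OF R])
next
  case (add p k v)
  show ?case
    by (rule is_subringD(6)[OF R add(1) single_in_subring[OF assms]])
qed

lemma range_mpol_eval:
  "range (mpol_eval of_int f) = is_subring hull (range f)"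
proof
  have "p \<in> {p. mpol_eval of_int f p \<in> is_subring hull (range f)}" for p
    by (rule mpol_in_subring)
      (auto simp: is_subring_def of_int_coeff.mpol_eval_simps subring_hull_closed hull_inc)
  then show "range (mpol_eval of_int f) \<subseteq> is_subring hull (range f)"
    by auto
  have "is_subring (range (mpol_eval of_int f))"
    unfolding is_subring_def
    by (intro conjI ballI; (elim rangeE)?)
      (metis of_int_coeff.mpol_eval_one rangeI, metis of_int_coeff.mpol_eval_diff rangeI,
        metis of_int_coeff.mpol_eval_mult rangeI)
  moreover have "range f \<subseteq> range (mpol_eval of_int f)"
    by (metis image_subsetI of_int_coeff.mpol_eval_mvar rangeI)
  ultimately show "is_subring hull (range f) \<subseteq> range (mpol_eval of_int f)"
    by (rule subring_hull_subset)
qed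

section \<open>Algebraic independence and specialization\<close>

definition alg_indep :: "('v \<Rightarrow> 'a::comm_ring_1) \<Rightarrow> bool" where
  "alg_indep x \<longleftrightarrow> (\<forall>p :: ('v, int) mpol. mpol_eval of_int x p = 0 \<longrightarrow> p = 0)"

lemma freely_generates_alg_indep:
  assumes "freely_generates x"
  shows "alg_indep (($) x)"
  unfolding alg_indep_def
proof safe
  fix p :: "(3, int) mpol"
  assume p: "mpol_eval of_int (($) x) p = 0"
  define q :: "(3, rat) mpol" where "q = Poly_Mapping.map of_int p"
  have l: "Poly_Mapping.lookup q m = of_int (Poly_Mapping.lookup p m)" for m
    by (simp add: q_def Poly_Mapping.map.rep_eq when_def)
  have "Poly_Mapping.keys q = Poly_Mapping.keys p"
    by (auto simp: in_keys_iff l)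
  then have "mpol_eval of_rat (($) x) q = mpol_eval of_int (($) x) p"
    by (simp add: mpol_eval_def l)
  then have "q = 0"
    using assms p by (simp add: freely_generates_def)
  then show "p = 0"
    using l by (intro poly_mapping_eqI) (metis lookup_zero of_int_eq_0_iff)
qed

text \<open>The partial homomorphism from the field to \<open>'k\<close> that sends \<open>x\<close> to the point \<open>p\<close>, as a
  relation; it is functional when \<open>x\<close> is algebraically independent.\<close>

definition specializes :: "('v \<Rightarrow> 'a::field_char_0) \<Rightarrow> ('v \<Rightarrow> 'k::field_char_0) \<Rightarrow> 'a \<Rightarrow> 'k \<Rightarrow> bool" where
  "specializes x p f v \<longleftrightarrow> (\<exists>P Q :: ('v, int) mpol. mpol_eval of_int p Q \<noteq> 0 \<and>
     f * mpol_eval of_int x Q = mpol_eval of_int x P \<and> v * mpol_eval of_int p Q = mpol_eval of_int p P)"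

context
  fixes x :: "'v \<Rightarrow> 'a::field_char_0" and p :: "'v \<Rightarrow> 'k::field_char_0"
begin

lemma specializes_1: "specializes x p 1 1"
  unfolding specializes_def
  by (intro exI[of _ 1]) (simp add: of_int_coeff.mpol_eval_simps)

lemma specializes_var: "specializes x p (x i) (p i)"
  unfolding specializes_def
  by (intro exI[of _ "mvar i"] exI[of _ 1]) (simp add: of_int_coeff.mpol_eval_simps)

lemma specializes_mult:
  assumes "specializes x p f u" "specializes x p g v"
  shows "specializes x p (f * g) (u * v)"
proof -
  from assms obtain P Q P' Q' where
    "mpol_eval of_int p Q \<noteq> 0" "mpol_eval of_int p Q' \<noteq> 0"
    "mpol_eval of_int x P = f * mpol_eval of_int x Q" "mpol_eval of_int p P = u * mpol_eval of_int p Q"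
    "mpol_eval of_int x P' = g * mpol_eval of_int x Q'" "mpol_eval of_int p P' = v * mpol_eval of_int p Q'"
    unfolding specializes_def by metis
  then show ?thesis
    unfolding specializes_def
    by (intro exI[of _ "P * P'"] exI[of _ "Q * Q'"]) (simp add: of_int_coeff.mpol_eval_simps)
qed

lemma specializes_diff:
  assumes "specializes x p f u" "specializes x p g v"
  shows "specializes x p (f - g) (u - v)"
proof -
  from assms obtain P Q P' Q' where
    "mpol_eval of_int p Q \<noteq> 0" "mpol_eval of_int p Q' \<noteq> 0"
    "mpol_eval of_int x P = f * mpol_eval of_int x Q" "mpol_eval of_int p P = u * mpol_eval of_int p Q"
    "mpol_eval of_int x P' = g * mpol_eval of_int x Q'" "mpol_eval of_int p P' = v * mpol_eval of_int p Q'"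
    unfolding specializes_def by metis
  then show ?thesis
    unfolding specializes_def
    by (intro exI[of _ "P * Q' - P' * Q"] exI[of _ "Q * Q'"])
      (simp add: of_int_coeff.mpol_eval_simps algebra_simps)
qed

lemma specializes_0: "specializes x p 0 0"
  using specializes_diff[OF specializes_1 specializes_1] by simp

lemma specializes_uminus: "specializes x p f u \<Longrightarrow> specializes x p (- f) (- u)"
  using specializes_diff[OF specializes_0] by fastforce

lemma specializes_add: "specializes x p f u \<Longrightarrow> specializes x p g v \<Longrightarrow> specializes x p (f + g) (u + v)"
  using specializes_diff[OF _ specializes_uminus, of f u g v] by simp

lemma specializes_power: "specializes x p f u \<Longrightarrow> specializes x p (f ^ n) (u ^ n)"
  by (induction n) (auto intro: specializes_1 specializes_mult)

lemma specializes_of_nat: "specializes x p (of_nat n) (of_nat n)"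
  by (induction n) (auto intro: specializes_0 specializes_1 specializes_add)

lemma specializes_numeral: "specializes x p (numeral w) (numeral w)"
  using specializes_of_nat[of "numeral w"] by simp

lemma specializes_of_int: "specializes x p (of_int k) (of_int k)"
proof (cases k rule: int_cases2)
  case (nonneg n)
  then show ?thesis using specializes_of_nat[of n] by simp
next
  case (nonpos n)
  then show ?thesis using specializes_uminus[OF specializes_of_nat[of n]] by simp
qed

lemma specializes_poly:
  assumes "specializes x p f u"
  shows "specializes x p (poly (map_poly of_int q) f) (poly (map_poly of_int q) u)"
  by (induction q) (auto simp: map_poly_pCons intro!: specializes_0 specializes_add
      specializes_mult specializes_of_int assms)

context
  assumes indep: "alg_indep x"
begin

text \<open>For two representations of \<open>f\<close> by fractions, \<open>P * Q' - P' * Q\<close>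
  vanishes at \<open>x\<close>. Independence makes it the zero polynomial, so it vanishes at
  \<open>p\<close> too, and the nonzero denominators cancel.\<close>

lemma specializes_unique:
  assumes "specializes x p f u" "specializes x p f v"
  shows "u = v"
proof -
  from assms obtain P Q P' Q' where
    nz: "mpol_eval of_int p Q \<noteq> 0" "mpol_eval of_int p Q' \<noteq> 0" and
    eq: "mpol_eval of_int x P = f * mpol_eval of_int x Q" "mpol_eval of_int p P = u * mpol_eval of_int p Q"
    "mpol_eval of_int x P' = f * mpol_eval of_int x Q'" "mpol_eval of_int p P' = v * mpol_eval of_int p Q'"
    unfolding specializes_def by metis
  have "mpol_eval of_int x (P * Q' - P' * Q) = 0"
    using eq by (simp add: of_int_coeff.mpol_eval_simps)
  then have "P * Q' - P' * Q = 0"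
    using indep unfolding alg_indep_def by blast
  then have "mpol_eval of_int p (P * Q' - P' * Q) = 0"
    by (simp add: of_int_coeff.mpol_eval_simps)
  then show ?thesis
    using eq nz by (simp add: of_int_coeff.mpol_eval_simps)
qed

lemma specializes_0D: "specializes x p 0 u \<Longrightarrow> u = 0"
  using specializes_unique specializes_0 by blast

lemma specializes_inverse:
  assumes "specializes x p f u" "u \<noteq> 0"
  shows "specializes x p (inverse f) (inverse u)"
proof -
  from assms(1) obtain P Q where
    nz: "mpol_eval of_int p Q \<noteq> 0" and
    eq: "f * mpol_eval of_int x Q = mpol_eval of_int x P" "u * mpol_eval of_int p Q = mpol_eval of_int p P"
    unfolding specializes_def by metis
  have "f \<noteq> 0"
    using assms specializes_0D by blast
  moreover have "mpol_eval of_int p P \<noteq> 0"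
    using nz eq assms by (metis mult_eq_0_iff)
  moreover have "inverse f * mpol_eval of_int x P = mpol_eval of_int x Q"
    "inverse u * mpol_eval of_int p P = mpol_eval of_int p Q"
    using eq \<open>f \<noteq> 0\<close> \<open>u \<noteq> 0\<close> by (auto simp: field_simps)
  ultimately show ?thesis
    unfolding specializes_def by blast
qed

lemma specializes_divide:
  assumes "specializes x p f u" "specializes x p g v" "v \<noteq> 0"
  shows "specializes x p (f / g) (u / v)"
  using specializes_mult[OF assms(1) specializes_inverse[OF assms(2,3)]] by (simp add: divide_inverse)

end

end

section \<open>Localization and comaximal elements\<close>

lemma localization_subring:
  assumes R: "is_subring R" and d: "d \<in> R"
  shows "is_subring {f. \<exists>n. f * d ^ n \<in> R}"
  unfolding is_subring_def
proof (intro conjI ballI)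
  show "1 \<in> {f. \<exists>n. f * d ^ n \<in> R}"
    using is_subringD(1)[OF R] by (auto intro: exI[of _ 0])
  fix f g assume "f \<in> {f. \<exists>n. f * d ^ n \<in> R}" "g \<in> {f. \<exists>n. f * d ^ n \<in> R}"
  then obtain m n where mn: "f * d ^ m \<in> R" "g * d ^ n \<in> R" by blast
  have "(f - g) * d ^ (m + n) = (f * d ^ m) * d ^ n - (g * d ^ n) * d ^ m"
    "(f * g) * d ^ (m + n) = (f * d ^ m) * (g * d ^ n)"
    by (simp_all add: power_add algebra_simps)
  then have "(f - g) * d ^ (m + n) \<in> R" "(f * g) * d ^ (m + n) \<in> R"
    using mn d is_subringD[OF R] by simp_all
  then show "f - g \<in> {f. \<exists>n. f * d ^ n \<in> R}" "f * g \<in> {f. \<exists>n. f * d ^ n \<in> R}"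
    by blast+
qed

lemma comaximal_power:
  assumes R: "is_subring R" and "d \<in> R" "e \<in> R" "\<exists>p\<in>R. \<exists>q\<in>R. d * p + e * q = 1"
  shows "\<exists>p\<in>R. \<exists>q\<in>R. d ^ n * p + e * q = 1"
proof (induction n)
  case 0
  show ?case
    using is_subringD[OF R] by (intro bexI[of _ 1] bexI[of _ 0]) auto
next
  case (Suc n)
  then obtain p q where pq: "p \<in> R" "q \<in> R" "d ^ n * p + e * q = 1" by blast
  from assms obtain p1 q1 where pq1: "p1 \<in> R" "q1 \<in> R" "d * p1 + e * q1 = 1" by blast
  have "d ^ Suc n * (p * p1) + e * (d ^ n * p * q1 + q) = d ^ n * p * (d * p1 + e * q1) + e * q"
    by (simp add: algebra_simps)
  also have "\<dots> = 1" using pq pq1 by simp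
  finally show ?case
    by (intro bexI[of _ "p * p1"] bexI[of _ "d ^ n * p * q1 + q"])
      (assumption | rule is_subringD[OF R] pq pq1 assms)+
qed

text \<open>Membership is local: powers of comaximal elements are again comaximal, and an expression
  of 1 through \<open>d ^ m\<close> and \<open>e ^ n\<close> reassembles \<open>f\<close> from its
  two cleared multiples.\<close>

lemma comaximal_localizations:
  assumes R: "is_subring R" and "d \<in> R" "e \<in> R" "\<exists>p\<in>R. \<exists>q\<in>R. d * p + e * q = 1"
    and f: "f * d ^ m \<in> R" "f * e ^ n \<in> R"
  shows "f \<in> R"
proof -
  have "\<exists>q\<in>R. \<exists>p\<in>R. e * q + d ^ m * p = 1"
    using comaximal_power[OF assms(1-4), of m] by (metis add.commute)
  then have "\<exists>q\<in>R. \<exists>p\<in>R. e ^ n * q + d ^ m * p = 1"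
    by (rule comaximal_power[OF R assms(3) is_subringD(7)[OF R assms(2)]])
  then obtain p q where pq: "p \<in> R" "q \<in> R" "e ^ n * q + d ^ m * p = 1" by blast
  have "f * (e ^ n * q + d ^ m * p) = (f * e ^ n) * q + (f * d ^ m) * p"
    by (simp add: algebra_simps)
  then have "f = (f * e ^ n) * q + (f * d ^ m) * p"
    using pq by simp
  moreover have "(f * e ^ n) * q + (f * d ^ m) * p \<in> R"
    by (rule is_subringD[OF R] pq f)+
  ultimately show ?thesis by simp
qed

lemma binomial_remainder:
  assumes R: "is_subring R" and "u \<in> R" "v \<in> R"
  shows "\<exists>w\<in>R. (u + v) ^ n = v ^ n + u * w"
proof (induction n)
  case 0
  show ?case using is_subringD[OF R] by (intro bexI[of _ 0]) auto
next
  case (Suc n)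
  then obtain w where w: "w \<in> R" "(u + v) ^ n = v ^ n + u * w" by blast
  have "(u + v) ^ Suc n = v ^ Suc n + u * (v ^ n + u * w + v * w)"
    by (simp add: w algebra_simps)
  moreover have "v ^ n + u * w + v * w \<in> R"
    by (rule is_subringD[OF R] assms w)+
  ultimately show ?case by blast
qed

text \<open>Modulo \<open>v\<close> both \<open>u\<close> and (because \<open>a \<ge> 2\<close>) \<open>v'\<close> are units of the target ring, so
  \<open>v\<close> and \<open>u v'\<close> are comaximal there.\<close>

lemma laurent_ring_double_mutation:
  fixes u v w u' v' v'' :: "'a::field_char_0"
  assumes nz: "u \<noteq> 0" "v \<noteq> 0" "w \<noteq> 0" "u' \<noteq> 0" "v' \<noteq> 0" "v'' \<noteq> 0"
    and u': "u * u' = v ^ a + w ^ b" and v': "v * v' = u ^ a + w ^ c"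
    and v'': "v * v'' = u' ^ a + w ^ (a * b - c)"
    and a: "2 \<le> a" and c: "c \<le> a * b"
    and f: "f \<in> laurent_ring {u', v, w}" "f \<in> laurent_ring {u, v', w}"
  shows "f \<in> laurent_ring {u', v'', w}"
proof -
  let ?R = "laurent_ring {u', v'', w}"
  note cl = laurent_ring_closed[where Z = "{u', v'', w}"]
  note R = is_subring_laurent_ring[where Z = "{u', v'', w}"]
  have base: "u' \<in> ?R" "v'' \<in> ?R" "w \<in> ?R" "inverse u' \<in> ?R" "inverse v'' \<in> ?R" "inverse w \<in> ?R"
    by (auto intro: laurent_ring_base)
  have "v = (u' ^ a + w ^ (a * b - c)) * inverse v''"
    using v'' nz by (simp add: field_simps)
  then have vR: "v \<in> ?R"
    by (metis (lifting) base cl(4,6,7))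
  have "u = (v ^ a + w ^ b) * inverse u'"
    using u' nz by (simp add: field_simps)
  then have uR: "u \<in> ?R"
    by (metis (lifting) base vR cl(4,6,7))
  obtain W where W: "W \<in> ?R" "(v ^ a + w ^ b) ^ a = (w ^ b) ^ a + v ^ a * W"
    using binomial_remainder[OF R cl(7)[OF vR] cl(7)[OF base(3)]] by blast
  obtain a' where a': "a = Suc (Suc a')"
    using a by (metis add_2_eq_Suc le_Suc_ex)
  \<comment> \<open>Expanding \<open>u * u'\<close> by its exchange relation, the terms without
    \<open>v ^ a\<close> regroup through w^(ab) = w^c w^(ab-c) into
    \<open>w ^ c * (v * v'')\<close>. So \<open>v\<close> cancels; because a = a' + 2, the other
    term keeps a further factor \<open>v\<close>.\<close>
  have "v * (u' ^ a * v') = (u * u') ^ a + w ^ c * u' ^ a"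
    using v' by (metis (no_types) distrib_right mult.assoc mult.commute power_mult_distrib)
  also have "\<dots> = v ^ a * W + (w ^ (a * b) + w ^ c * u' ^ a)"
    by (simp add: u' W power_mult[symmetric] mult.commute)
  also have "w ^ (a * b) = w ^ c * w ^ (a * b - c)"
    using c by (simp flip: power_add)
  also have "w ^ c * w ^ (a * b - c) + w ^ c * u' ^ a = w ^ c * (v * v'')"
    by (simp add: v'' distrib_left add.commute)
  also have "v ^ a * W + w ^ c * (v * v'') = v * (v ^ Suc a' * W + w ^ c * v'')"
    by (simp add: a' algebra_simps)
  finally have e1: "u' ^ a * v' = v * (v ^ a' * W) + w ^ c * v''"
    using nz by simp
  have "inverse u' ^ a * (u' ^ a * v') = v'"
    using nz by (simp flip: mult.assoc power_mult_distrib)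
  moreover have "inverse u' ^ a * (u' ^ a * v') \<in> ?R"
    unfolding e1 by (rule cl base vR W(1))+
  ultimately have v'R: "v' \<in> ?R"
    by metis
  \<comment> \<open>All of \<open>u'\<close>, \<open>v\<close>, \<open>w\<close> lie in
    \<open>?R\<close>, and \<open>u'\<close>, \<open>w\<close> are units there, so clearing
    \<open>v\<close> suffices. For the other Laurent ring, where \<open>w\<close> is a unit,
    clearing \<open>u * v'\<close> suffices.\<close>
  have "\<exists>n. f * v ^ n \<in> ?R"
  proof -
    have "laurent_ring {u', v, w} \<subseteq> {f. \<exists>n. f * v ^ n \<in> ?R}"
    proof (rule laurent_ring_subset)
      show "is_subring {f. \<exists>n. f * v ^ n \<in> ?R}"
        by (rule localization_subring[OF R vR])
      have "inverse v * v ^ 1 \<in> ?R"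
        using nz cl by simp
      then show "{u', v, w} \<subseteq> {f. \<exists>n. f * v ^ n \<in> ?R}" "inverse ` {u', v, w} \<subseteq> {f. \<exists>n. f * v ^ n \<in> ?R}"
        using base vR by (auto intro: exI[of _ 0] exI[of _ 1])
    qed
    then show ?thesis using f by blast
  qed
  moreover have "\<exists>n. f * (u * v') ^ n \<in> ?R"
  proof -
    have "laurent_ring {u, v', w} \<subseteq> {f. \<exists>n. f * (u * v') ^ n \<in> ?R}"
    proof (rule laurent_ring_subset)
      show "is_subring {f. \<exists>n. f * (u * v') ^ n \<in> ?R}"
        using cl uR v'R by (intro localization_subring[OF R])
      have "inverse u * (u * v') ^ 1 = v'" "inverse v' * (u * v') ^ 1 = u"
        using nz by (simp_all add: field_simps)
      then have "inverse u * (u * v') ^ 1 \<in> ?R" "inverse v' * (u * v') ^ 1 \<in> ?R"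
        using uR v'R by metis+
      then show "{u, v', w} \<subseteq> {f. \<exists>n. f * (u * v') ^ n \<in> ?R}"
          "inverse ` {u, v', w} \<subseteq> {f. \<exists>n. f * (u * v') ^ n \<in> ?R}"
        using base uR v'R by (auto intro: exI[of _ 0] exI[of _ 1])
    qed
    then show ?thesis using f by blast
  qed
  moreover have "\<exists>p\<in>?R. \<exists>q\<in>?R. v * p + (u * v') * q = 1"
  proof -
    \<comment> \<open>Modulo \<open>v\<close>, the product of \<open>u * v'\<close> and
      \<open>u' ^ Suc a\<close> is \<open>w ^ (b + c) * v''\<close>, a unit of \<open>?R\<close>;
      \<open>i\<close> is its inverse.\<close>
    define i where "i = inverse w ^ (b + c) * inverse v''"
    have i: "i \<in> ?R"
      unfolding i_def by (rule base cl)+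
    have i1: "w ^ (b + c) * v'' * i = 1"
      using nz by (simp add: i_def field_simps)
    have "(u * v') * u' ^ Suc a = (u * u') * (u' ^ a * v')"
      by simp
    also have "\<dots> = (v ^ a + w ^ b) * (v * (v ^ a' * W) + w ^ c * v'')"
      by (simp only: e1 u')
    also have "\<dots> = v * (v ^ Suc a' * (v * (v ^ a' * W) + w ^ c * v'') + w ^ b * (v ^ a' * W)) + w ^ (b + c) * v''"
      by (simp add: a' power_add algebra_simps)
    finally have e2: "(u * v') * u' ^ Suc a
      = v * (v ^ Suc a' * (v * (v ^ a' * W) + w ^ c * v'') + w ^ b * (v ^ a' * W)) + w ^ (b + c) * v''" .
    define q where "q = v ^ Suc a' * (v * (v ^ a' * W) + w ^ c * v'') + w ^ b * (v ^ a' * W)"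
    have "v * (- q * i) + (u * v') * (u' ^ Suc a * i) = ((u * v') * u' ^ Suc a - v * q) * i"
      by (simp add: algebra_simps)
    also have "(u * v') * u' ^ Suc a - v * q = w ^ (b + c) * v''"
      unfolding e2 q_def by simp
    also note i1
    finally have "v * (- q * i) + (u * v') * (u' ^ Suc a * i) = 1" .
    moreover have "- q * i \<in> ?R" "u' ^ Suc a * i \<in> ?R"
      unfolding q_def by (rule i vR W(1) base cl)+
    ultimately show ?thesis by blast
  qed
  ultimately show ?thesis
    using comaximal_localizations[OF R vR, of "u * v'" f] cl uR v'R by blast
qed

section \<open>Cyclic exchange matrices of Markov type\<close>

text \<open>\<open>s\<close> is the orientation of the 3-cycle, and \<open>a\<close>,
  \<open>b\<close>, \<open>c\<close> are the weights of the arrows opposite the vertices 1, 2, 3.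
  The cubic expression is the mutation invariant familiar from the Markov equation.\<close>

definition markov_cyclic :: "int ^ 3 ^ 3 \<Rightarrow> bool" where
  "markov_cyclic B \<longleftrightarrow> (\<exists>s a b c. (s = 1 \<or> s = -1) \<and> 2 \<le> a \<and> 2 \<le> b \<and> 2 \<le> c \<and>
     a\<^sup>2 + b\<^sup>2 + c\<^sup>2 - a * b * c = 4 \<and>
     B = vector [vector [0, s * c, - s * b], vector [- s * c, 0, s * a], vector [s * b, - s * a, 0]])"

lemma markov_cyclic_B332: "markov_cyclic B332"
  unfolding markov_cyclic_def B332_def
  by (rule exI[of _ "-1"], rule exI[of _ 3], rule exI[of _ 2], rule exI[of _ 3]) simp

lemma vector3_eq_iff: "(A :: 'b ^ 3 ^ 3) = B \<longleftrightarrow> (\<forall>i j. A $ i $ j = B $ i $ j)"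
  by (simp add: vec_eq_iff)

text \<open>This is Vieta jumping: a b - c is the other root of the invariant read as a quadratic in
  c, and the weight produced by mutation. The equation turns into (c - 2)(a b - c - 2) = (a - b)^2,
  which settles c > 2; for c = 2 it forces a = b.\<close>

lemma markov_third_ge_2:
  fixes a b c :: int
  assumes "2 \<le> a" "2 \<le> b" "2 \<le> c" "a\<^sup>2 + b\<^sup>2 + c\<^sup>2 - a * b * c = 4"
  shows "2 \<le> a * b - c"
proof (cases "c = 2")
  case True
  then have "(a - b)\<^sup>2 = 0"
    using assms(4) by (simp add: power2_eq_square algebra_simps)
  then have "a = b" by simp
  moreover have "2 * 2 \<le> a * b"
    using assms by (intro mult_mono) auto
  ultimately show ?thesis using True by simp
next
  case False
  have "(c - 2) * (a * b - c - 2) = (a - b)\<^sup>2"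
    using assms(4) by (simp add: power2_eq_square algebra_simps)
  then have "0 \<le> (c - 2) * (a * b - c - 2)" by simp
  then show ?thesis
    using False assms(3) by (simp add: zero_le_mult_iff)
qed

lemma markov_cyclic_mutate:
  assumes "markov_cyclic B"
  shows "markov_cyclic (mutate_matrix k B)"
proof -
  from assms obtain s a b c where s: "s = 1 \<or> s = -1" and ge: "2 \<le> a" "2 \<le> b" "2 \<le> c"
    and eq: "a\<^sup>2 + b\<^sup>2 + c\<^sup>2 - a * b * c = 4"
    and B: "B = vector [vector [0, s * c, - s * b], vector [- s * c, 0, s * a], vector [s * b, - s * a, 0]]"
    unfolding markov_cyclic_def by blast
  consider "k = 1" | "k = 2" | "k = 3" using exhaust_3 by blast
  then show ?thesis
  proof cases
    case 1
    have "2 \<le> b * c - a"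
      using markov_third_ge_2[of b c a] ge eq by (simp add: algebra_simps)
    moreover have "(b * c - a)\<^sup>2 + b\<^sup>2 + c\<^sup>2 - (b * c - a) * b * c = 4"
      using eq by (simp add: power2_eq_square algebra_simps)
    moreover have "mutate_matrix k B = vector [vector [0, - s * c, - (- s) * b],
        vector [- (- s) * c, 0, - s * (b * c - a)], vector [- s * b, - (- s) * (b * c - a), 0]]"
      using s ge by (elim disjE)
        (simp_all add: 1 B vector3_eq_iff forall_3 mutate_matrix_def abs_mult algebra_simps)
    moreover have "- s = 1 \<or> - s = -1"
      using s by auto
    ultimately show ?thesis
      using ge unfolding markov_cyclic_def by blast
  next
    case 2
    have "2 \<le> a * c - b"
      using markov_third_ge_2[of a c b] ge eq by (simp add: algebra_simps)
    moreover have "a\<^sup>2 + (a * c - b)\<^sup>2 + c\<^sup>2 - a * (a * c - b) * c = 4"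
      using eq by (simp add: power2_eq_square algebra_simps)
    moreover have "mutate_matrix k B = vector [vector [0, - s * c, - (- s) * (a * c - b)],
        vector [- (- s) * c, 0, - s * a], vector [- s * (a * c - b), - (- s) * a, 0]]"
      using s ge by (elim disjE)
        (simp_all add: 2 B vector3_eq_iff forall_3 mutate_matrix_def abs_mult algebra_simps)
    moreover have "- s = 1 \<or> - s = -1"
      using s by auto
    ultimately show ?thesis
      using ge unfolding markov_cyclic_def by blast
  next
    case 3
    have "2 \<le> a * b - c"
      using markov_third_ge_2[of a b c] ge eq by (simp add: algebra_simps)
    moreover have "a\<^sup>2 + b\<^sup>2 + (a * b - c)\<^sup>2 - a * b * (a * b - c) = 4"
      using eq by (simp add: power2_eq_square algebra_simps)
    moreover have "mutate_matrix k B = vector [vector [0, - s * (a * b - c), - (- s) * b],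
        vector [- (- s) * (a * b - c), 0, - s * a], vector [- s * b, - (- s) * a, 0]]"
      using s ge by (elim disjE)
        (simp_all add: 3 B vector3_eq_iff forall_3 mutate_matrix_def abs_mult algebra_simps)
    moreover have "- s = 1 \<or> - s = -1"
      using s by auto
    ultimately show ?thesis
      using ge unfolding markov_cyclic_def by blast
  qed
qed

lemma bij_3_cases:
  assumes "bij (\<pi> :: 3 \<Rightarrow> 3)"
  shows "(\<pi> 1, \<pi> 2, \<pi> 3) \<in> {(1,2,3), (1,3,2), (2,1,3), (2,3,1), (3,1,2), (3,2,1)}"
proof -
  have "\<pi> 1 \<noteq> \<pi> 2" "\<pi> 1 \<noteq> \<pi> 3" "\<pi> 2 \<noteq> \<pi> 3"
    using injD[OF bij_is_inj[OF assms], of 1 2] injD[OF bij_is_inj[OF assms], of 1 3]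
      injD[OF bij_is_inj[OF assms], of 2 3] by auto
  then show ?thesis
    using exhaust_3[of "\<pi> 1"] exhaust_3[of "\<pi> 2"] exhaust_3[of "\<pi> 3"]
    by (elim disjE) simp_all
qed

lemma markov_cyclic_permute:
  assumes "markov_cyclic B" "bij \<pi>"
  shows "markov_cyclic (\<chi> i j. B $ \<pi> i $ \<pi> j)"
proof -
  from assms obtain s a b c where s: "s = 1 \<or> s = -1" and ge: "2 \<le> a" "2 \<le> b" "2 \<le> c"
    and eq: "a\<^sup>2 + b\<^sup>2 + c\<^sup>2 - a * b * c = 4"
    and B: "B = vector [vector [0, s * c, - s * b], vector [- s * c, 0, s * a], vector [s * b, - s * a, 0]]"
    unfolding markov_cyclic_def by blast
  have skew: "B $ i $ j = - B $ j $ i" for i j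
    using exhaust_3[of i] exhaust_3[of j] by (auto simp: B)
  have *: "markov_cyclic (\<chi> i j. B $ \<pi> i $ \<pi> j)"
    if "s' = 1 \<or> s' = -1" "2 \<le> a'" "2 \<le> b'" "2 \<le> c'" "a'\<^sup>2 + b'\<^sup>2 + c'\<^sup>2 - a' * b' * c' = 4"
      "B $ \<pi> 1 $ \<pi> 2 = s' * c'" "B $ \<pi> 2 $ \<pi> 3 = s' * a'" "B $ \<pi> 3 $ \<pi> 1 = s' * b'" for s' a' b' c'
  proof -
    have "(\<chi> i j. B $ \<pi> i $ \<pi> j)
        = vector [vector [0, s' * c', - s' * b'], vector [- s' * c', 0, s' * a'], vector [s' * b', - s' * a', 0]]"
      using that(6-8) skew[of "\<pi> 1" "\<pi> 1"] skew[of "\<pi> 2" "\<pi> 2"] skew[of "\<pi> 3" "\<pi> 3"]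
        skew[of "\<pi> 2" "\<pi> 1"] skew[of "\<pi> 3" "\<pi> 2"] skew[of "\<pi> 1" "\<pi> 3"]
      by (simp add: vector3_eq_iff forall_3)
    with that(1-5) show ?thesis
      unfolding markov_cyclic_def by blast
  qed
  \<comment> \<open>An odd permutation reverses the orientation of the 3-cycle, hence the second
    sign; the weights are merely permuted.\<close>
  have "\<exists>s' \<in> {s, - s}. \<exists>(a', b', c') \<in> {(a,b,c), (a,c,b), (b,a,c), (b,c,a), (c,a,b), (c,b,a)}.
      B $ \<pi> 1 $ \<pi> 2 = s' * c' \<and> B $ \<pi> 2 $ \<pi> 3 = s' * a' \<and> B $ \<pi> 3 $ \<pi> 1 = s' * b'"
    using bij_3_cases[OF assms(2)] by (elim insertE emptyE) (simp_all add: B)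
  then obtain s' a' b' c' where s': "s' \<in> {s, - s}"
    and abc: "(a', b', c') \<in> {(a,b,c), (a,c,b), (b,a,c), (b,c,a), (c,a,b), (c,b,a)}"
    and B': "B $ \<pi> 1 $ \<pi> 2 = s' * c'" "B $ \<pi> 2 $ \<pi> 3 = s' * a'" "B $ \<pi> 3 $ \<pi> 1 = s' * b'"
    by blast
  have "s' = 1 \<or> s' = -1" using s s' by auto
  moreover have "2 \<le> a'" "2 \<le> b'" "2 \<le> c'" using ge abc by auto
  moreover have "a'\<^sup>2 + b'\<^sup>2 + c'\<^sup>2 - a' * b' * c' = 4"
    using abc eq by (elim insertE emptyE) (simp_all add: ac_simps)
  ultimately show ?thesis by (rule *[OF _ _ _ _ _ B'])
qed

section \<open>Mutation at a vertex of a cyclic matrix\<close>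

lemma prod_Collect_3:
  "(\<Prod>j | P j. f (j :: 3)) = (if P 1 then f 1 else 1) * (if P 2 then f 2 else 1) * (if P 3 then f 3 else 1)"
  for f :: "3 \<Rightarrow> 'b::comm_monoid_mult"
proof -
  have "(\<Prod>j | P j. f j) = (\<Prod>j\<in>UNIV. if P j then f j else 1)"
    using prod.inter_filter[of UNIV f P] by simp
  also have "\<dots> = (\<Prod>j\<in>{1, 2, 3}. if P j then f j else 1)"
    by (simp only: UNIV_3)
  finally show ?thesis
    by (simp add: mult.assoc)
qed

lemma UNIV_3_distinct:
  assumes "k \<noteq> j" "j \<noteq> l" "k \<noteq> (l :: 3)"
  shows "UNIV = {k, j, l}"
proof -
  have "card {k, j, l} = card (UNIV :: 3 set)"
    using assms by simp
  then show ?thesis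
    by (metis card_subset_eq finite subset_UNIV)
qed

lemma range_3_distinct:
  assumes "k \<noteq> j" "j \<noteq> l" "k \<noteq> (l :: 3)"
  shows "range f = {f k, f j, f l}"
  using UNIV_3_distinct[OF assms] by auto

lemma exists_other_3:
  obtains j l :: 3 where "k \<noteq> j" "j \<noteq> l" "k \<noteq> l"
proof -
  have "\<exists>j l :: 3. k \<noteq> j \<and> j \<noteq> l \<and> k \<noteq> l"
    using exhaust_3[of k]
    by (elim disjE)
      (rule exI[of _ 2], rule exI[of _ 3], simp, rule exI[of _ 1], rule exI[of _ 3], simp,
        rule exI[of _ 1], rule exI[of _ 2], simp)
  then show ?thesis using that by blast
qed

text \<open>At every vertex of the 3-cycle one arrow enters and one leaves. So each product in the
  exchange relation is a single power, and reversing the orientation only swaps the two summands.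
  The new weight has no outer absolute value because \<open>markov_third_ge_2\<close> fixes its
  sign.\<close>

lemma
  assumes B: "markov_cyclic B" and d: "k \<noteq> j" "j \<noteq> l" "k \<noteq> (l :: 3)"
  shows mutate_vars_markov_cyclic:
      "mutate_vars k (z, B) $ k = (z $ j ^ nat \<bar>B $ j $ k\<bar> + z $ l ^ nat \<bar>B $ l $ k\<bar>) / z $ k"
    and markov_cyclic_abs_sym: "\<bar>B $ j $ k\<bar> = \<bar>B $ k $ j\<bar>"
    and markov_cyclic_ge_2: "2 \<le> \<bar>B $ j $ k\<bar>"
    and mutate_matrix_markov_cyclic:
      "\<bar>mutate_matrix k B $ l $ j\<bar> = \<bar>B $ j $ k\<bar> * \<bar>B $ l $ k\<bar> - \<bar>B $ l $ j\<bar>"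
proof -
  from B obtain s a b c where s: "s = 1 \<or> s = -1" and ge: "2 \<le> a" "2 \<le> b" "2 \<le> c"
    and eq: "a\<^sup>2 + b\<^sup>2 + c\<^sup>2 - a * b * c = 4"
    and B: "B = vector [vector [0, s * c, - s * b], vector [- s * c, 0, s * a], vector [s * b, - s * a, 0]]"
    unfolding markov_cyclic_def by blast
  have ge': "2 \<le> b * c - a" "2 \<le> a * c - b" "2 \<le> a * b - c"
    using markov_third_ge_2[of b c a] markov_third_ge_2[of a c b] markov_third_ge_2[of a b c] ge eq
    by (simp_all add: algebra_simps)
  have kjl: "(k, j, l) \<in> {(1,2,3), (1,3,2), (2,1,3), (2,3,1), (3,1,2), (3,2,1)}"
    using exhaust_3[of k] exhaust_3[of j] exhaust_3[of l] d by (elim disjE) simp_all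
  show "\<bar>B $ j $ k\<bar> = \<bar>B $ k $ j\<bar>"
    using kjl by (elim insertE emptyE) (simp_all add: B)
  show "2 \<le> \<bar>B $ j $ k\<bar>"
    using kjl s ge by (elim insertE emptyE disjE) (simp_all add: B)
  show "mutate_vars k (z, B) $ k = (z $ j ^ nat \<bar>B $ j $ k\<bar> + z $ l ^ nat \<bar>B $ l $ k\<bar>) / z $ k"
    using kjl s ge by (elim insertE emptyE disjE)
      (simp_all add: B mutate_vars_def Let_def prod_Collect_3 divide_inverse)
  show "\<bar>mutate_matrix k B $ l $ j\<bar> = \<bar>B $ j $ k\<bar> * \<bar>B $ l $ k\<bar> - \<bar>B $ l $ j\<bar>"
    using kjl s ge ge' by (elim insertE emptyE disjE)
      (simp_all add: B mutate_matrix_def abs_mult algebra_simps)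
qed

lemma mutate_vars_other: "i \<noteq> k \<Longrightarrow> mutate_vars k s $ i = fst s $ i"
  by (simp add: mutate_vars_def Let_def)

lemma mutate_matrix_involution: "mutate_matrix k (mutate_matrix k B) = B"
proof -
  \<comment> \<open>Integer \<open>div\<close> rounds down, so it commutes with negation here only
    because the numerator is even.\<close>
  have "(- (\<bar>a\<bar> * b) - a * \<bar>b\<bar>) div 2 = - ((\<bar>a\<bar> * b + a * \<bar>b\<bar>) div 2)" for a b :: int
  proof -
    have "even (\<bar>a\<bar> * b + a * \<bar>b\<bar>)"
      by (cases "a \<ge> 0"; cases "b \<ge> 0") simp_all
    then obtain m where m: "\<bar>a\<bar> * b + a * \<bar>b\<bar> = 2 * m" by blast
    have "- (\<bar>a\<bar> * b) - a * \<bar>b\<bar> = 2 * (- m)"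
      using m by simp
    then show ?thesis using m by (metis nonzero_mult_div_cancel_left zero_neq_numeral)
  qed
  then show ?thesis
    by (simp add: mutate_matrix_def vec_eq_iff)
qed

text \<open>Membership of all cluster variables in such a set is how they are seen to be nonzero.\<close>

definition positive_set :: "'a::field set \<Rightarrow> bool" where
  "positive_set S \<longleftrightarrow> 0 \<notin> S \<and> 1 \<in> S \<and> (\<forall>a\<in>S. inverse a \<in> S \<and> (\<forall>b\<in>S. a + b \<in> S \<and> a * b \<in> S))"

lemma positive_set_power: "positive_set S \<Longrightarrow> a \<in> S \<Longrightarrow> a ^ n \<in> S"
  by (induction n) (auto simp: positive_set_def)

lemma positive_set_mutate:
  assumes S: "positive_set S" and B: "markov_cyclic B" and z: "\<And>i. z $ i \<in> S"
  shows "mutate_vars k (z, B) $ i \<in> S"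
proof (cases "i = k")
  case True
  obtain j l where d: "k \<noteq> j" "j \<noteq> l" "k \<noteq> l"
    by (rule exists_other_3)
  show ?thesis
    using S z positive_set_power[OF S]
    unfolding True mutate_vars_markov_cyclic[OF B d] divide_inverse positive_set_def by blast
qed (use z in \<open>simp add: mutate_vars_other\<close>)

text \<open>The hypothesis is on the mutated variable, since a mutation step also has to be undone
  when only its target is understood.\<close>

lemma mutate_vars_involution:
  assumes S: "positive_set S" and B: "markov_cyclic B" and k: "mutate_vars k (z, B) $ k \<in> S"
  shows "mutate_vars k (mutate k (z, B)) = z"
proof -
  obtain j l where d: "k \<noteq> j" "j \<noteq> l" "k \<noteq> l"
    by (rule exists_other_3)
  \<comment> \<open>Division by 0 yields 0, so a nonzero quotient also certifies that its numerator
    and \<open>z $ k\<close> are nonzero, as the back mutation requires.\<close>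
  have "mutate_vars k (z, B) $ k \<noteq> 0"
    using S k by (auto simp: positive_set_def)
  moreover have "\<bar>mutate_matrix k B $ j $ k\<bar> = \<bar>B $ j $ k\<bar>" "\<bar>mutate_matrix k B $ l $ k\<bar> = \<bar>B $ l $ k\<bar>"
    by (simp_all add: mutate_matrix_def)
  ultimately have "mutate_vars k (mutate k (z, B)) $ k = z $ k"
    using mutate_vars_markov_cyclic[OF markov_cyclic_mutate[OF B] d, where z = "mutate_vars k (z, B)"] d
    unfolding mutate_def fst_conv snd_conv
    by (simp add: mutate_vars_markov_cyclic[OF B d] mutate_vars_other)
  moreover have "mutate_vars k (mutate k (z, B)) $ i = z $ i" if "i \<noteq> k" for i
    using that by (simp add: mutate_vars_other mutate_def)
  ultimately show ?thesis
    by (metis vec_eq_iff)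
qed

section \<open>Passing from a seed to its neighbours\<close>

text \<open>Membership in the upper bound of Berenstein, Fomin and Zelevinsky: the Laurent ring of a
  seed intersected with those of its adjacent seeds.\<close>

definition in_upper_bound :: "'a::field_char_0 \<Rightarrow> 'a seed \<Rightarrow> bool" where
  "in_upper_bound f s \<longleftrightarrow> f \<in> laurent_ring (range (($) (fst s))) \<and>
     (\<forall>k. f \<in> laurent_ring (range (($) (mutate_vars k s))))"

definition good_seed :: "'a::field_char_0 set \<Rightarrow> 'a \<Rightarrow> 'a seed \<Rightarrow> bool" where
  "good_seed S f s \<longleftrightarrow> markov_cyclic (snd s) \<and> (\<forall>i. fst s $ i \<in> S) \<and> in_upper_bound f s"

lemma range_mutate_vars:
  assumes d: "k \<noteq> j" "j \<noteq> l" "k \<noteq> l"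
  shows "range (($) (mutate_vars k (z, B))) = {mutate_vars k (z, B) $ k, z $ j, z $ l}"
  using d by (simp add: range_3_distinct[OF d] mutate_vars_other)

text \<open>Among the neighbours of the new seed, the one at \<open>k\<close> is the old seed. The
  one at some other \<open>j\<close> is two mutations away from the old seed, and
  \<open>laurent_ring_double_mutation\<close> reaches it with u, v, w the old variables at k, j and
  the third index l.\<close>

lemma good_seed_mutate:
  assumes S: "positive_set S" and s: "good_seed S f s"
  shows "good_seed S f (mutate k s)"
proof -
  obtain z B where zB: "s = (z, B)" by fastforce
  have B: "markov_cyclic B" and z: "\<And>i. z $ i \<in> S" and f: "f \<in> laurent_ring (range (($) z))"
    "\<And>k. f \<in> laurent_ring (range (($) (mutate_vars k (z, B))))"
    using s by (auto simp: good_seed_def in_upper_bound_def zB)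
  define z' where "z' = mutate_vars k (z, B)"
  define B' where "B' = mutate_matrix k B"
  have B': "markov_cyclic B'"
    unfolding B'_def by (rule markov_cyclic_mutate[OF B])
  have z': "z' $ i \<in> S" for i
    unfolding z'_def by (rule positive_set_mutate[OF S B z])
  have nz: "a \<noteq> 0" if "a \<in> S" for a
    using that S by (auto simp: positive_set_def)
  have "f \<in> laurent_ring (range (($) (mutate_vars j (z', B'))))" for j
  proof (cases "j = k")
    case True
    then have "mutate_vars j (z', B') = z"
      using mutate_vars_involution[OF S B z'[unfolded z'_def]] by (simp add: mutate_def z'_def B'_def)
    with f show ?thesis by simp
  next
    case False
    define l where "l = (SOME l. l \<noteq> k \<and> l \<noteq> j)"
    have "\<exists>l. l \<noteq> k \<and> l \<noteq> j"
      using exists_other_3[of k] by metis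
    then have d: "k \<noteq> j" "j \<noteq> l" "k \<noteq> l"
      unfolding l_def using False by (metis (mono_tags, lifting) someI)+
    define a b c where "a = nat \<bar>B $ j $ k\<bar>" and "b = nat \<bar>B $ l $ k\<bar>" and "c = nat \<bar>B $ l $ j\<bar>"
    have a2: "2 \<le> a"
      using markov_cyclic_ge_2[OF B d] by (simp add: a_def)
    have e: "nat \<bar>B $ k $ j\<bar> = a" "nat \<bar>B' $ k $ j\<bar> = a"
      using markov_cyclic_abs_sym[OF B d] by (simp_all add: a_def B'_def mutate_matrix_def)
    have m: "\<bar>B' $ l $ j\<bar> = \<bar>B $ j $ k\<bar> * \<bar>B $ l $ k\<bar> - \<bar>B $ l $ j\<bar>"
      unfolding B'_def by (rule mutate_matrix_markov_cyclic[OF B d])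
    then have "\<bar>B $ l $ j\<bar> \<le> \<bar>B $ j $ k\<bar> * \<bar>B $ l $ k\<bar>"
      by (metis abs_ge_zero diff_ge_0_iff_ge)
    then have c: "c \<le> a * b"
      by (simp add: a_def b_def c_def nat_abs_mult_distrib[symmetric] abs_mult)
    \<comment> \<open>This subtraction of naturals is a true one, by the bound on \<open>c\<close>
      just established.\<close>
    have e': "nat \<bar>B' $ l $ j\<bar> = a * b - c"
      unfolding m by (simp add: a_def b_def c_def nat_diff_distrib' nat_mult_distrib)
    have d': "j \<noteq> k" "k \<noteq> l" "j \<noteq> l" using d by auto
    have zk: "z' $ k = (z $ j ^ a + z $ l ^ b) / z $ k"
      unfolding z'_def a_def b_def by (rule mutate_vars_markov_cyclic[OF B d])
    have o: "z' $ j = z $ j" "z' $ l = z $ l"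
      using d by (simp_all add: z'_def mutate_vars_other)
    have v': "mutate_vars j (z, B) $ j = (z $ k ^ a + z $ l ^ c) / z $ j"
      using mutate_vars_markov_cyclic[OF B d'] by (simp add: e c_def)
    have v'': "mutate_vars j (z', B') $ j = (z' $ k ^ a + z $ l ^ (a * b - c)) / z $ j"
      using mutate_vars_markov_cyclic[OF B' d', where z = z'] by (simp add: e e' o)
    have "f \<in> laurent_ring {z' $ k, mutate_vars j (z', B') $ j, z $ l}"
    proof (rule laurent_ring_double_mutation)
      show "z $ k \<noteq> 0" "z $ j \<noteq> 0" "z $ l \<noteq> 0" "z' $ k \<noteq> 0" "mutate_vars j (z, B) $ j \<noteq> 0"
          "mutate_vars j (z', B') $ j \<noteq> 0"
        using nz z z' positive_set_mutate[OF S B z] positive_set_mutate[OF S B' z'] by blast+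
      then show "z $ k * z' $ k = z $ j ^ a + z $ l ^ b"
        "z $ j * mutate_vars j (z, B) $ j = z $ k ^ a + z $ l ^ c"
        "z $ j * mutate_vars j (z', B') $ j = z' $ k ^ a + z $ l ^ (a * b - c)"
        by (simp_all add: zk v' v'')
      show "2 \<le> a" "c \<le> a * b" by fact+
      show "f \<in> laurent_ring {z' $ k, z $ j, z $ l}"
        using f(2)[of k] by (simp add: range_mutate_vars[OF d] z'_def)
      show "f \<in> laurent_ring {z $ k, mutate_vars j (z, B) $ j, z $ l}"
        using f(2)[of j] by (simp add: range_mutate_vars[OF d'] insert_commute)
    qed
    then show ?thesis
      by (simp add: range_mutate_vars[OF d'] o insert_commute)
  qed
  then show ?thesis
    using B' z' f(2)[of k] by (simp add: good_seed_def in_upper_bound_def zB mutate_def flip: z'_def B'_def)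
qed

lemma good_seed_permute:
  assumes s: "good_seed S f s" and \<pi>: "bij \<pi>"
  shows "good_seed S f (permute_seed \<pi> s)"
proof -
  obtain z B where zB: "s = (z, B)" by fastforce
  have B: "markov_cyclic B" and z: "\<And>i. z $ i \<in> S" and f: "f \<in> laurent_ring (range (($) z))"
    "\<And>k. f \<in> laurent_ring (range (($) (mutate_vars k (z, B))))"
    using s by (auto simp: good_seed_def in_upper_bound_def zB)
  define z' :: "'a ^ 3" where "z' = (\<chi> i. z $ \<pi> i)"
  define B' :: "int ^ 3 ^ 3" where "B' = (\<chi> i j. B $ \<pi> i $ \<pi> j)"
  have B': "markov_cyclic B'"
    unfolding B'_def by (rule markov_cyclic_permute[OF B \<pi>])
  have "range (($) (mutate_vars k (z', B'))) = range (($) (mutate_vars (\<pi> k) (z, B)))" for k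
  proof -
    obtain j l where d: "k \<noteq> j" "j \<noteq> l" "k \<noteq> l"
      by (rule exists_other_3)
    then have d': "\<pi> k \<noteq> \<pi> j" "\<pi> j \<noteq> \<pi> l" "\<pi> k \<noteq> \<pi> l"
      using injD[OF bij_is_inj[OF \<pi>]] by blast+
    show ?thesis
      unfolding range_mutate_vars[OF d] range_mutate_vars[OF d']
        mutate_vars_markov_cyclic[OF B' d] mutate_vars_markov_cyclic[OF B d']
      by (simp add: z'_def B'_def)
  qed
  moreover have "range (($) z') = range (($) z)"
  proof -
    have "range (($) z') = ($) z ` range \<pi>"
      by (auto simp: z'_def)
    then show ?thesis
      using \<pi> by (simp add: bij_is_surj)
  qed
  ultimately show ?thesis
    using B' z f by (simp add: good_seed_def in_upper_bound_def zB permute_seed_def flip: z'_def B'_def)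
      (simp add: z'_def)
qed

text \<open>Mutation equivalence also follows steps backwards, from a seed about which nothing is
  known. Its matrix is recovered as a mutation of the known one, after which the step turns into a
  forward mutation, or into the inverse permutation.\<close>

lemma good_seed_step:
  assumes S: "positive_set S" and st: "seed_step s t \<or> seed_step t s" and s: "good_seed S f s"
  shows "good_seed S f t"
  using st
proof
  assume "seed_step s t"
  then show ?thesis
    by cases (use good_seed_mutate[OF S s] good_seed_permute[OF s] in auto)
next
  assume "seed_step t s"
  then show ?thesis
  proof cases
    case (1 k)
    obtain z B where zB: "t = (z, B)" by fastforce
    have "markov_cyclic (mutate_matrix k (snd s))"
      using s markov_cyclic_mutate by (auto simp: good_seed_def)
    then have B: "markov_cyclic B"
      by (simp add: 1 zB mutate_def mutate_matrix_involution)
    have "mutate_vars k (z, B) $ k \<in> S"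
      using s by (simp add: good_seed_def 1 zB mutate_def)
    then have "mutate k s = t"
      using mutate_vars_involution[OF S B] by (simp add: 1 zB mutate_def mutate_matrix_involution)
    then show ?thesis
      using good_seed_mutate[OF S s, of k] by simp
  next
    case (2 \<pi>)
    have "permute_seed (inv \<pi>) s = t"
      using 2 by (simp add: permute_seed_def vec_eq_iff bij_is_surj surj_f_inv_f prod_eq_iff)
    then show ?thesis
      using good_seed_permute[OF s bij_imp_bij_inv[OF 2(3)]] by simp
  qed
qed

lemma good_seed_in_upper_cluster_algebra:
  assumes S: "positive_set S" and s: "good_seed S f s"
  shows "f \<in> upper_cluster_algebra s"
  unfolding upper_cluster_algebra_def clusters_def
proof safe
  fix z C
  assume "mutation_equivalent s (z, C)"
  then have "equivclp seed_step s (z, C)"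
    by (simp add: mutation_equivalent_def)
  then have "good_seed S f (z, C)"
    by induction (use s good_seed_step[OF S] in blast)+
  then show "f \<in> laurent_ring (range (($) z))"
    by (simp add: good_seed_def in_upper_bound_def)
qed

section \<open>Normal forms modulo the nine relations\<close>

text \<open>The outer variable is evaluated at \<open>b\<close>, the coefficients at \<open>a\<close>.\<close>

definition eval2 :: "int poly poly \<Rightarrow> 'r \<Rightarrow> 'r \<Rightarrow> 'r::comm_ring_1" where
  "eval2 p a b = poly (map_poly (\<lambda>q. poly (map_poly of_int q) a) p) b"

lemma poly_of_int_add:
  "poly (map_poly of_int (p + q)) (a :: 'r::comm_ring_1) = poly (map_poly of_int p) a + poly (map_poly of_int q) a"
  by (induction p q rule: poly_induct2) (auto simp: map_poly_pCons algebra_simps)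

lemma eval2_simps:
  "eval2 0 a b = 0"
  "eval2 (pCons q p) a b = poly (map_poly of_int q) a + b * eval2 p a b"
  by (simp_all add: eval2_def map_poly_pCons)

lemma eval2_add: "eval2 (p + q) a b = eval2 p a b + eval2 q a b"
  by (induction p q rule: poly_induct2) (auto simp: eval2_simps poly_of_int_add algebra_simps)

lemma eval2_uminus: "eval2 (- p) a b = - eval2 p a b"
  using eval2_add[of p "- p" a b] by (simp add: eval2_simps eq_neg_iff_add_eq_0 add.commute)

lemma eval2_1: "eval2 1 a b = 1"
  by (simp add: one_pCons eval2_simps map_poly_pCons)

lemma eval2_times_fst: "eval2 (map_poly (pCons 0) p) a b = a * eval2 p a b"
  by (induction p) (auto simp: eval2_simps map_poly_pCons algebra_simps)

lemma mpol_eval_poly: "mpol_eval of_int f (poly (map_poly of_int q) p) = poly (map_poly of_int q) (mpol_eval of_int f p)"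
  by (induction q) (simp_all add: map_poly_pCons of_int_coeff.mpol_eval_simps)

lemma mpol_eval_eval2:
  "mpol_eval of_int f (eval2 p a b) = eval2 p (mpol_eval of_int f a) (mpol_eval of_int f b)"
  by (induction p) (auto simp: eval2_simps of_int_coeff.mpol_eval_simps mpol_eval_poly)

lemma specializes_eval2:
  "specializes x p a a' \<Longrightarrow> specializes x p b b' \<Longrightarrow> specializes x p (eval2 q a b) (eval2 q a' b')"
  by (induction q)
    (auto simp: eval2_simps intro!: specializes_0 specializes_add specializes_mult specializes_poly)

text \<open>These are the monomials in x2, z, y1, y2 divisible by none of the left-hand products
  x2^3, x2^2 z, x2 y1, z^2, z y1, z y2, y1^2, y1 y2, y2^2 of the rewriting rules
  \<open>red_x2_cubed\<close> to \<open>red_y2_y2\<close> below.\<close>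

definition basis332 :: "'r \<Rightarrow> 'r \<Rightarrow> 'r \<Rightarrow> 'r \<Rightarrow> nat \<Rightarrow> 'r::comm_ring_1" where
  "basis332 x2 z y1 y2 i = [1, x2, x2\<^sup>2, z, x2 * z, y2, x2 * y2, x2\<^sup>2 * y2, y1] ! i"

definition comb332 :: "(nat \<Rightarrow> int poly poly) \<Rightarrow> 'r \<Rightarrow> 'r \<Rightarrow> 'r \<Rightarrow> 'r \<Rightarrow> 'r \<Rightarrow> 'r \<Rightarrow> 'r::comm_ring_1" where
  "comb332 m x2 x3 z y1 y2 y3 = (\<Sum>i<9. eval2 (m i) x3 y3 * basis332 x2 z y1 y2 i)"

lemma lessThan_9: "{..<9::nat} = {0, 1, 2, 3, 4, 5, 6, 7, 8}"
  by auto

lemma comb332_expand: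
  "comb332 m x2 x3 z y1 y2 y3 =
     eval2 (m 0) x3 y3 + eval2 (m 1) x3 y3 * x2 + eval2 (m 2) x3 y3 * x2\<^sup>2
   + eval2 (m 3) x3 y3 * z + eval2 (m 4) x3 y3 * (x2 * z)
   + eval2 (m 5) x3 y3 * y2 + eval2 (m 6) x3 y3 * (x2 * y2) + eval2 (m 7) x3 y3 * (x2\<^sup>2 * y2)
   + eval2 (m 8) x3 y3 * y1"
  by (simp add: comb332_def basis332_def lessThan_9 add.assoc)

locale relations332_ring =
  fixes x1 x2 x3 y0 y1 y2 y3 z :: "'r::comm_ring_1" and I :: "'r set"
  assumes I: "is_ideal I"
    and z: "z = y0 - 1"
    and rel1: "y2\<^sup>2 - (y0 * y3 + 2 * y3) \<in> I"
    and rel2: "y0\<^sup>2 - (x2 * y2 - y0 + 2) \<in> I"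
    and rel3: "y1 * y2 - (x1 * y3 + x3 * y3) \<in> I"
    and rel4: "y0 * y2 - (x2 * y3 + y2) \<in> I"
    and rel5: "y0 * y1 - (x1 * y2 + x3 * y2 - 2 * y1) \<in> I"
    and rel6: "(x1 * y0 + x3 * y0) - (x2 * y1 + x1 + x3) \<in> I"
    and rel7: "x2\<^sup>2 * y2 - (x1 * x3 * y3 + 3 * x2 * y0 - y1\<^sup>2 - 3 * x2) \<in> I"
    and rel8: "x2\<^sup>2 * y0 - (x1 * x3 * y2 + x2\<^sup>2 - x1 * y1 - x3 * y1) \<in> I"
    and rel9: "(x2 ^ 3 + x3\<^sup>2 * y0) - (x2 * x3 * y1 - x1\<^sup>2 + x1 * x3) \<in> I"
begin

lemma red_y2_y2: "y2 * y2 - (y3 * z + 3 * y3) \<in> I"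
  using rel1 by (simp add: z algebra_simps power2_eq_square)

lemma red_z_z: "z * z - (x2 * y2 - 3 * z) \<in> I"
  using rel2 by (simp add: z algebra_simps power2_eq_square)

lemma red_y1_y2: "y1 * y2 - (x1 * y3 + x3 * y3) \<in> I"
  by (rule rel3)

lemma red_z_y2: "z * y2 - y3 * x2 \<in> I"
  using rel4 by (simp add: z algebra_simps)

lemma red_z_y1: "z * y1 - (x1 * y2 + x3 * y2 - 3 * y1) \<in> I"
  using rel5 by (simp add: z algebra_simps)

lemma red_x2_y1: "x2 * y1 - (x1 * z + x3 * z) \<in> I"
  using is_idealD(5)[OF I rel6] by (simp add: z algebra_simps)

lemma red_y1_y1: "y1 * y1 - (x1 * (x3 * y3) + 3 * (x2 * z) - x2\<^sup>2 * y2) \<in> I"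
  using rel7 by (simp add: z algebra_simps power2_eq_square)

lemma red_x2_x2_z: "x2\<^sup>2 * z - (x1 * (x3 * y2) - x1 * y1 - x3 * y1) \<in> I"
  using rel8 by (simp add: z algebra_simps)

lemma red_x2_cubed: "x2 ^ 3 - (x1 * (x3 * z) - x1 * x1 + x1 * x3 - x3 * x3) \<in> I"
proof -
  \<comment> \<open>The last relation still contains x2 x3 y1, itself a reducible product; adding x3
    times the rule for x2 y1 removes it.\<close>
  have "x2 ^ 3 - (x1 * (x3 * z) - x1 * x1 + x1 * x3 - x3 * x3)
      = ((x2 ^ 3 + x3\<^sup>2 * y0) - (x2 * x3 * y1 - x1\<^sup>2 + x1 * x3)) + x3 * (x2 * y1 - (x1 * z + x3 * z))"
    by (simp add: z algebra_simps power2_eq_square)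
  also have "\<dots> \<in> I"
    by (intro is_idealD[OF I] rel9 red_x2_y1)
  finally show ?thesis .
qed

abbreviation comb :: "(nat \<Rightarrow> int poly poly) \<Rightarrow> 'r" where
  "comb m \<equiv> comb332 m x2 x3 z y1 y2 y3"

text \<open>Polynomials in \<open>x1\<close> whose coefficients are combinations of the nine basis elements, modulo \<open>I\<close>.\<close>

inductive_set T :: "'r set" where
  zero: "0 \<in> T"
| step: "p \<in> T \<Longrightarrow> r \<in> I \<Longrightarrow> comb m + x1 * p + r \<in> T"

lemma comb_add: "comb m + comb m' = comb (\<lambda>i. m i + m' i)"
  by (simp add: comb332_def eval2_add sum.distrib distrib_right)

lemma comb_0: "comb (\<lambda>_. 0) = 0"
  by (simp add: comb332_def eval2_simps)

lemma T_step: "p \<in> T \<Longrightarrow> r \<in> I \<Longrightarrow> t = comb m + x1 * p + r \<Longrightarrow> t \<in> T"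
  using step by simp

lemma T_I: "r \<in> I \<Longrightarrow> r \<in> T"
  by (rule T_step[OF zero, of r _ "\<lambda>_. 0"]) (simp_all add: comb_0)

lemma T_comb: "comb m \<in> T"
  by (rule T_step[OF zero is_idealD(1)[OF I], of _ m]) simp

lemma T_add:
  assumes "p \<in> T" "q \<in> T"
  shows "p + q \<in> T"
  using assms
proof (induction arbitrary: q)
  case zero
  then show ?case by simp
next
  case (step p r m)
  from step.prems show ?case
  proof cases
    case zero
    then show ?thesis using T.step[OF step.hyps] by simp
  next
    case (step q' r' m')
    show ?thesis
      unfolding step
      by (rule T_step[OF step.IH[OF step(2)] is_idealD(2)[OF I \<open>r \<in> I\<close> step(3)], of _ "\<lambda>i. m i + m' i"])
        (simp add: comb_add[symmetric] algebra_simps)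
  qed
qed

lemma T_x1: "p \<in> T \<Longrightarrow> x1 * p \<in> T"
  by (rule T_step[OF _ is_idealD(1)[OF I], of p _ "\<lambda>_. 0"]) (simp_all add: comb_0)

text \<open>For multipliers that act on the coefficients alone: x3, y3 and -1.\<close>

lemma T_mult_comb:
  assumes "\<And>m. \<exists>m'. u * comb m = comb m'" "p \<in> T"
  shows "u * p \<in> T"
  using assms(2)
proof induction
  case zero
  then show ?case by (simp add: T.zero)
next
  case (step p r m)
  obtain m' where "u * comb m = comb m'" using assms(1) by blast
  then show ?case
    by (intro T_step[OF step.IH is_idealD(3)[OF I step.hyps(2)], of _ m' u]) (simp add: algebra_simps)
qed

lemma T_x3: "p \<in> T \<Longrightarrow> x3 * p \<in> T"
proof (erule T_mult_comb[rotated])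
  fix m
  have "x3 * comb m = comb (\<lambda>i. map_poly (pCons 0) (m i))"
    by (simp add: comb332_def eval2_times_fst sum_distrib_left mult.assoc)
  then show "\<exists>m'. x3 * comb m = comb m'" by blast
qed

lemma T_y3: "p \<in> T \<Longrightarrow> y3 * p \<in> T"
proof (erule T_mult_comb[rotated])
  fix m
  have "y3 * comb m = comb (\<lambda>i. pCons 0 (m i))"
    by (simp add: comb332_def eval2_simps sum_distrib_left mult.assoc)
  then show "\<exists>m'. y3 * comb m = comb m'" by blast
qed

lemma T_uminus: "p \<in> T \<Longrightarrow> - p \<in> T"
proof -
  have "- 1 * comb m = comb (\<lambda>i. - m i)" for m
    by (simp add: comb332_def eval2_uminus sum_negf)
  then show "p \<in> T \<Longrightarrow> - p \<in> T"
    using T_mult_comb[of "- 1" p] by fastforce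
qed

lemma T_diff: "p \<in> T \<Longrightarrow> q \<in> T \<Longrightarrow> p - q \<in> T"
  using T_add[OF _ T_uminus, of p q] by simp

lemma T_of_nat: "p \<in> T \<Longrightarrow> of_nat n * p \<in> T"
  by (induction n) (auto simp: distrib_right zero intro: T_add)

lemma T_numeral: "p \<in> T \<Longrightarrow> numeral w * p \<in> T"
  using T_of_nat[of p "numeral w"] by simp

lemma T_basis: "i < 9 \<Longrightarrow> basis332 x2 z y1 y2 i \<in> T"
proof -
  assume i: "i < 9"
  have "comb (\<lambda>j. if j = i then 1 else 0) = (\<Sum>j<9. if j = i then basis332 x2 z y1 y2 j else 0)"
    unfolding comb332_def by (rule sum.cong) (auto simp: eval2_simps eval2_1)
  also have "\<dots> = basis332 x2 z y1 y2 i"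
    using i by simp
  finally show ?thesis using T_comb by metis
qed

lemma T_basis_elems: "1 \<in> T" "x2 \<in> T" "x2\<^sup>2 \<in> T" "z \<in> T" "x2 * z \<in> T" "y2 \<in> T" "x2 * y2 \<in> T"
  "x2\<^sup>2 * y2 \<in> T" "y1 \<in> T"
  using T_basis[of 0] T_basis[of 1] T_basis[of 2] T_basis[of 3] T_basis[of 4] T_basis[of 5]
    T_basis[of 6] T_basis[of 7] T_basis[of 8] by (simp_all add: basis332_def)

lemma T_vars: "x1 \<in> T" "x3 \<in> T" "y3 \<in> T"
  using T_x1 T_x3 T_y3 T_basis_elems(1) by fastforce+

lemmas T_intros = T_basis_elems T_vars T_add T_diff T_x1 T_x3 T_y3 T_numeral

text \<open>One rewriting step: inside the product \<open>q * l\<close> the rule replaces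
  \<open>l\<close> by \<open>r\<close>, and the expanded result \<open>s\<close> has to be in
  \<open>T\<close> already.\<close>

lemma T_reduce:
  assumes "l - r \<in> I" "a = q * l" "q * r = s" "s \<in> T"
  shows "a \<in> T"
proof -
  have "a = s + q * (l - r)"
    using assms(2,3) by (simp add: algebra_simps)
  then show ?thesis
    using T_add[OF assms(4) T_I[OF is_idealD(3)[OF I assms(1)]]] by simp
qed

lemma T_x2_cubed: "x2 ^ 3 \<in> T"
  by (rule T_reduce[OF red_x2_cubed, of _ 1]) (simp, rule mult_1_left, intro T_intros)

lemma T_z_y2: "z * y2 \<in> T"
  by (rule T_reduce[OF red_z_y2, of _ 1]) (simp, rule mult_1_left, intro T_intros)

lemma T_z_z: "z * z \<in> T"
  by (rule T_reduce[OF red_z_z, of _ 1]) (simp, rule mult_1_left, intro T_intros)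

lemma T_x2_x2_z: "x2\<^sup>2 * z \<in> T"
  by (rule T_reduce[OF red_x2_x2_z, of _ 1]) (simp, rule mult_1_left, intro T_intros)

lemma T_z_y1: "z * y1 \<in> T"
  by (rule T_reduce[OF red_z_y1, of _ 1]) (simp, rule mult_1_left, intro T_intros)

lemma T_x2_y1: "x2 * y1 \<in> T"
  by (rule T_reduce[OF red_x2_y1, of _ 1]) (simp, rule mult_1_left, intro T_intros)

lemma T_y1_y2: "y1 * y2 \<in> T"
  by (rule T_reduce[OF red_y1_y2, of _ 1]) (simp, rule mult_1_left, intro T_intros)

lemma T_y2_y2: "y2 * y2 \<in> T"
  by (rule T_reduce[OF red_y2_y2, of _ 1]) (simp, rule mult_1_left, intro T_intros)

lemma T_y1_y1: "y1 * y1 \<in> T"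
  by (rule T_reduce[OF red_y1_y1, of _ 1]) (simp, rule mult_1_left, intro T_intros)

lemmas T_products = T_x2_cubed T_z_y2 T_z_z T_x2_x2_z T_z_y1 T_x2_y1 T_y1_y2 T_y2_y2 T_y1_y1

lemma T_x2_cubed_y2: "x2 ^ 3 * y2 \<in> T"
  by (rule T_reduce[OF red_x2_cubed, of _ y2 "x1 * (x3 * (z * y2)) - x1 * (x1 * y2) + x1 * (x3 * y2) - x3 * (x3 * y2)"])
    (simp, simp add: algebra_simps, intro T_intros T_products)

lemma T_x2_z_z: "x2 * (z * z) \<in> T"
  by (rule T_reduce[OF red_z_z, of _ x2 "x2\<^sup>2 * y2 - 3 * (x2 * z)"])
    (simp, simp add: algebra_simps power2_eq_square, intro T_intros)

lemma T_x2_z_y2: "x2 * (z * y2) \<in> T"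
  by (rule T_reduce[OF red_z_y2, of _ x2 "y3 * x2\<^sup>2"])
    (simp, simp add: algebra_simps power2_eq_square, intro T_intros)

lemma T_x2_x2_z_y2: "x2\<^sup>2 * (z * y2) \<in> T"
  by (rule T_reduce[OF red_z_y2, of _ "x2\<^sup>2" "y3 * x2 ^ 3"])
    (simp, simp add: algebra_simps eval_nat_numeral, intro T_intros T_products)

lemma T_x2_y2_y2: "x2 * (y2 * y2) \<in> T"
  by (rule T_reduce[OF red_y2_y2, of _ x2 "y3 * (x2 * z) + 3 * (y3 * x2)"])
    (simp, simp add: algebra_simps, intro T_intros)

lemma T_x2_x2_y2_y2: "x2\<^sup>2 * (y2 * y2) \<in> T"
  by (rule T_reduce[OF red_y2_y2, of _ "x2\<^sup>2" "y3 * (x2\<^sup>2 * z) + 3 * (y3 * x2\<^sup>2)"])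
    (simp, simp add: algebra_simps, intro T_intros T_products)

lemma T_x2_x2_y1: "x2\<^sup>2 * y1 \<in> T"
  by (rule T_reduce[OF red_x2_y1, of _ x2 "x1 * (x2 * z) + x3 * (x2 * z)"])
    (simp add: power2_eq_square, simp add: algebra_simps, intro T_intros)

lemma T_x2_z_y1: "x2 * (z * y1) \<in> T"
  by (rule T_reduce[OF red_x2_y1, of _ z "x1 * (z * z) + x3 * (z * z)"])
    (simp add: algebra_simps, simp add: algebra_simps, intro T_intros T_products)

lemma T_x2_y1_y2: "x2 * (y1 * y2) \<in> T"
  by (rule T_reduce[OF red_y1_y2, of _ x2 "x1 * (y3 * x2) + x3 * (y3 * x2)"])
    (simp, simp add: algebra_simps, intro T_intros T_products)

lemma T_x2_x2_y1_y2: "x2\<^sup>2 * (y1 * y2) \<in> T"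
  by (rule T_reduce[OF red_y1_y2, of _ "x2\<^sup>2" "x1 * (y3 * x2\<^sup>2) + x3 * (y3 * x2\<^sup>2)"])
    (simp, simp add: algebra_simps, intro T_intros T_products)

lemmas T_products' = T_x2_cubed_y2 T_x2_z_z T_x2_z_y2 T_x2_x2_z_y2 T_x2_y2_y2 T_x2_x2_y2_y2
  T_x2_x2_y1 T_x2_z_y1 T_x2_y1_y2 T_x2_x2_y1_y2

lemma T_eval2: "p \<in> T \<Longrightarrow> eval2 q x3 y3 * p \<in> T"
proof (induction q)
  case 0
  then show ?case by (simp add: eval2_simps zero)
next
  case (pCons k q)
  have "poly (map_poly of_int k) x3 * p \<in> T"
  proof (induction k)
    case 0
    then show ?case by (simp add: zero)
  next
    case (pCons n k)
    have "of_int n * p \<in> T"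
      by (cases n rule: int_cases2) (use T_of_nat[OF \<open>p \<in> T\<close>] in \<open>auto intro: T_uminus\<close>)
    moreover have "x3 * (poly (map_poly of_int k) x3 * p) \<in> T"
      by (rule T_x3[OF pCons.IH])
    ultimately show ?case
      using T_add by (simp add: map_poly_pCons algebra_simps)
  qed
  then show ?case
    using T_add[OF _ T_y3[OF pCons.IH[OF pCons.prems]]] by (simp add: eval2_simps algebra_simps)
qed

text \<open>For multipliers that move the basis elements themselves: since \<open>T\<close> absorbs
  coefficients and x1, nine products remain to be checked.\<close>

lemma T_mult_basis:
  assumes "\<And>i. i < 9 \<Longrightarrow> u * basis332 x2 z y1 y2 i \<in> T" and p: "p \<in> T"
  shows "u * p \<in> T"
  using p
proof induction
  case zero
  then show ?case by (simp add: T.zero)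
next
  case (step p r m)
  have "(\<Sum>i\<in>A. eval2 (m i) x3 y3 * (u * basis332 x2 z y1 y2 i)) \<in> T" if "A \<subseteq> {..<9}" for A
    using finite_subset[OF that finite_lessThan] that
    by (induction rule: finite_induct) (auto simp: T.zero intro!: T_add T_eval2 assms(1))
  from this[OF order_refl] have "u * comb m \<in> T"
    by (simp add: comb332_def sum_distrib_left mult.left_commute)
  then have "u * comb m + x1 * (u * p) + u * r \<in> T"
    by (rule T_add[OF T_add[OF _ T_x1[OF step.IH]] T_I[OF is_idealD(3)[OF I step.hyps(2)]]])
  then show ?case
    by (simp add: algebra_simps)
qed

lemma T_mult:
  assumes "u \<in> {x1, x2, x3, y0, y1, y2, y3}" and p: "p \<in> T"
  shows "u * p \<in> T"
proof -
  have basis_cases: "u * basis332 x2 z y1 y2 i \<in> T"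
    if "i < 9" "u * 1 \<in> T" "u * x2 \<in> T" "u * x2\<^sup>2 \<in> T" "u * z \<in> T" "u * (x2 * z) \<in> T" "u * y2 \<in> T"
      "u * (x2 * y2) \<in> T" "u * (x2\<^sup>2 * y2) \<in> T" "u * y1 \<in> T" for u i
  proof -
    have "i \<in> {0, 1, 2, 3, 4, 5, 6, 7, 8}" using that(1) by auto
    then show ?thesis using that(2-) by (elim insertE emptyE) (simp_all add: basis332_def)
  qed
  have x2: "x2 * p \<in> T" if "p \<in> T" for p
    by (rule T_mult_basis[OF basis_cases that])
      (use T_intros(1-12) T_products T_products' in
        \<open>simp_all add: power2_eq_square power3_eq_cube mult.assoc\<close>)
  have zz: "z * p \<in> T" if "p \<in> T" for p
    by (rule T_mult_basis[OF basis_cases that])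
      (use T_intros(1-12) T_products T_products' in
        \<open>simp_all add: power2_eq_square power3_eq_cube ac_simps\<close>)
  have y2: "y2 * p \<in> T" if "p \<in> T" for p
    by (rule T_mult_basis[OF basis_cases that])
      (use T_intros(1-12) T_products T_products' in
        \<open>simp_all add: power2_eq_square power3_eq_cube ac_simps\<close>)
  have y1: "y1 * p \<in> T" if "p \<in> T" for p
    by (rule T_mult_basis[OF basis_cases that])
      (use T_intros(1-12) T_products T_products' in
        \<open>simp_all add: power2_eq_square power3_eq_cube ac_simps\<close>)
  have "y0 * p \<in> T"
    using T_add[OF zz[OF p] p] by (simp add: z algebra_simps)
  then show ?thesis
    using assms x2 y1 y2 T_x1 T_x3 T_y3 by auto
qed

end

section \<open>Specializing polynomials and Laurent polynomials\<close>

lemma specializes_mpol_eval: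
  assumes "\<And>i. specializes x p (f i) (g i)"
  shows "specializes x p (mpol_eval of_int f P) (mpol_eval of_int g P)"
proof -
  have "P \<in> {P. specializes x p (mpol_eval of_int f P) (mpol_eval of_int g P)}"
    by (rule mpol_in_subring)
      (auto simp: is_subring_def of_int_coeff.mpol_eval_simps
        intro: specializes_1 specializes_diff specializes_mult assms)
  then show ?thesis by simp
qed

lemma specializes_laurent_ring:
  assumes x: "alg_indep x" and Z: "\<And>z. z \<in> Z \<Longrightarrow> \<exists>u. u \<noteq> 0 \<and> specializes x p z u"
    and g: "g \<in> laurent_ring Z"
  shows "\<exists>w. specializes x p g w"
proof -
  have "is_subring {g. \<exists>w. specializes x p g w}"
    unfolding is_subring_def using specializes_1 specializes_diff specializes_mult by blast
  then have "laurent_ring Z \<subseteq> {g. \<exists>w. specializes x p g w}"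
    by (rule laurent_ring_subset) (use Z specializes_inverse[OF x] in blast)+
  with g show ?thesis by blast
qed

text \<open>With all initial variables set to 1, positivity of the values survives sums, products
  and inverses. Exchange relations use nothing else, so no cluster variable can vanish.\<close>

lemma positive_set_specializes:
  assumes "alg_indep x"
  shows "positive_set {f. \<exists>v :: rat. 0 < v \<and> specializes x (\<lambda>_. 1) f v}"
  unfolding positive_set_def
proof (intro conjI ballI)
  show "0 \<notin> {f. \<exists>v :: rat. 0 < v \<and> specializes x (\<lambda>_. 1) f v}"
    using specializes_0D[OF assms] by fastforce
  show "1 \<in> {f. \<exists>v :: rat. 0 < v \<and> specializes x (\<lambda>_. 1) f v}"
    using specializes_1 zero_less_one by blast
next
  fix f assume "f \<in> {f. \<exists>v :: rat. 0 < v \<and> specializes x (\<lambda>_. 1) f v}"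
  then obtain v :: rat where v: "0 < v" "specializes x (\<lambda>_. 1) f v" by blast
  have "0 < inverse v" "v \<noteq> 0" using v by auto
  then show "inverse f \<in> {f. \<exists>v :: rat. 0 < v \<and> specializes x (\<lambda>_. 1) f v}"
    using specializes_inverse[OF assms v(2)] by blast
  fix g assume "g \<in> {f. \<exists>v :: rat. 0 < v \<and> specializes x (\<lambda>_. 1) f v}"
  then obtain w :: rat where w: "0 < w" "specializes x (\<lambda>_. 1) g w" by blast
  show "f + g \<in> {f. \<exists>v :: rat. 0 < v \<and> specializes x (\<lambda>_. 1) f v}"
    "f * g \<in> {f. \<exists>v :: rat. 0 < v \<and> specializes x (\<lambda>_. 1) f v}"
    using specializes_add[OF v(2) w(2)] specializes_mult[OF v(2) w(2)] v(1) w(1)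
      add_pos_pos mult_pos_pos by blast+
qed

section \<open>Independence of the nine elements at x1 = 0\<close>

text \<open>The powers 1, X, X^2 are independent over k[W]: the three constant coefficients form a
  polynomial of degree below 3 divisible by W, hence 0; then W cancels and one coefficient fewer is
  left. It serves both for W = w^2 (w + 3) up to a scalar and for W = t^3.\<close>

lemma pcompose_cubic_independent:
  fixes W :: "'k::field poly"
  assumes W: "degree W = 3"
    and "pcompose A W + [:0, 1:] * pcompose B W + [:0, 0, 1:] * pcompose C W = 0"
  shows "A = 0 \<and> B = 0 \<and> C = 0"
proof -
  have "A = 0 \<and> B = 0 \<and> C = 0"
    if "\<And>k. k \<ge> n \<Longrightarrow> coeff A k = 0 \<and> coeff B k = 0 \<and> coeff C k = 0"
      "pcompose A W + [:0, 1:] * pcompose B W + [:0, 0, 1:] * pcompose C W = 0" for n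
    using that
  proof (induction n arbitrary: A B C)
    case 0
    then show ?case by (simp add: poly_eq_iff)
  next
    case (Suc n)
    obtain a A' b B' c C' where ABC: "A = pCons a A'" "B = pCons b B'" "C = pCons c C'"
      by (metis pCons_cases)
    define S where "S = pcompose A' W + [:0, 1:] * pcompose B' W + [:0, 0, 1:] * pcompose C' W"
    have "pcompose A W + [:0, 1:] * pcompose B W + [:0, 0, 1:] * pcompose C W = [:a, b, c:] + W * S"
      by (simp add: ABC S_def pcompose_pCons algebra_simps)
    then have eq: "[:a, b, c:] + W * S = 0"
      using Suc.prems(2) by simp
    then have "[:a, b, c:] = W * (- S)"
      by (simp add: eq_neg_iff_add_eq_0)
    then have "W dvd [:a, b, c:]" by (rule dvdI)
    moreover have "degree [:a, b, c:] < degree W"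
      by (simp add: W degree_pCons_eq_if)
    ultimately have abc: "[:a, b, c:] = 0"
      using dvd_imp_degree_le leD by blast
    then have "W * S = 0" using eq by simp
    then have "S = 0" using W by auto
    moreover have "coeff A' k = 0 \<and> coeff B' k = 0 \<and> coeff C' k = 0" if "k \<ge> n" for k
      using Suc.prems(1)[of "Suc k"] that by (simp add: ABC)
    ultimately have "A' = 0 \<and> B' = 0 \<and> C' = 0"
      using Suc.IH[of A' B' C'] unfolding S_def by blast
    then show ?case using abc by (simp add: ABC)
  qed
  from this[of "Suc (max (degree A) (max (degree B) (degree C)))"] assms(2) show ?thesis
    by (metis (no_types, lifting) Suc_le_eq coeff_eq_0 max_less_iff_conj)
qed

text \<open>Identities obtained from specialization miss one point, t = 0 or \<zeta> = -1, where a
  variable to be inverted would become 0.\<close>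

lemma poly_eq_0_off_point:
  fixes P :: "'k::field_char_0 poly"
  assumes "\<And>t. t \<noteq> c \<Longrightarrow> poly P t = 0"
  shows "P = 0"
proof -
  have "poly ([:- c, 1:] * P) t = 0" for t
    using assms[of t] by (cases "t = c") auto
  then have "[:- c, 1:] * P = 0"
    using poly_all_0_iff_0 by blast
  then show ?thesis
    by (metis mult_eq_0_iff pCons_eq_0_iff zero_neq_one)
qed

lemma cube_residues_independent:
  fixes A B C :: "int poly"
  assumes "\<And>t :: real. t \<noteq> 0 \<Longrightarrow> poly (map_poly of_int A) (t ^ 3) + t * poly (map_poly of_int B) (t ^ 3)
     + t\<^sup>2 * poly (map_poly of_int C) (t ^ 3) = 0"
  shows "A = 0 \<and> B = 0 \<and> C = 0"
proof -
  define W :: "real poly" where "W = monom 1 3"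
  let ?r = "map_poly of_int :: int poly \<Rightarrow> real poly"
  have "pcompose (?r A) W + [:0, 1:] * pcompose (?r B) W + [:0, 0, 1:] * pcompose (?r C) W = 0"
    by (rule poly_eq_0_off_point[of 0])
      (use assms in \<open>simp add: poly_pcompose W_def poly_monom power2_eq_square algebra_simps\<close>)
  moreover have "degree W = 3"
    by (simp add: W_def degree_monom_eq)
  ultimately have "?r A = 0 \<and> ?r B = 0 \<and> ?r C = 0"
    by (rule pcompose_cubic_independent[rotated])
  then have "coeff (?r A) k = 0 \<and> coeff (?r B) k = 0 \<and> coeff (?r C) k = 0" for k by simp
  then show ?thesis
    by (simp add: coeff_map_poly poly_eq_iff)
qed

lemma poly_of_int_simps:
  "poly (map_poly of_int (- p)) (t :: 'k::comm_ring_1) = - poly (map_poly of_int p) t"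
  "poly (map_poly of_int (pCons 0 p)) t = t * poly (map_poly of_int p) t"
proof -
  show "poly (map_poly of_int (- p)) t = - poly (map_poly of_int p) t"
    using poly_of_int_add[of p "- p" t] by (simp add: eq_neg_iff_add_eq_0 add.commute)
qed (simp add: map_poly_pCons)

lemma comb332_independent:
  assumes "\<And>t \<zeta> :: real. t \<noteq> 0 \<Longrightarrow> \<zeta> \<noteq> -1 \<Longrightarrow>
     comb332 m (- t\<^sup>2) (t ^ 3) \<zeta> (- t * \<zeta>) (- (\<zeta> * (\<zeta> + 3)) / t\<^sup>2) (\<zeta>\<^sup>2 * (\<zeta> + 3) / t ^ 4) = 0"
    and i: "i < 9"
  shows "m i = 0"
proof -
  define e :: "nat \<Rightarrow> nat \<Rightarrow> real \<Rightarrow> real" where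
    "e i n t = poly (map_poly of_int (coeff (m i) n)) (t ^ 3)" for i n t
  have main: "e 0 n t - t\<^sup>2 * e 1 n t + t ^ 4 * e 2 n t = 0 \<and>
      e 3 n t - t\<^sup>2 * e 4 n t - t * e 8 n t = 0 \<and>
      t\<^sup>2 * e 6 n t - e 5 n t - t ^ 4 * e 7 n t = 0" if t: "t \<noteq> 0" for n t
  proof -
    define p where "p i = map_poly (\<lambda>q. poly (map_poly of_int q) (t ^ 3)) (m i)" for i
    \<comment> \<open>For fixed t this is the value of y3 as a polynomial in \<zeta>.
      \<open>A\<close> collects the basis elements constant in \<zeta>, \<open>B\<close> those that
      are multiples of \<zeta>, \<open>C\<close> those that are multiples of \<zeta> (\<zeta> +
      3).\<close>
    define W :: "real poly" where "W = smult (1 / t ^ 4) [:0, 0, 3, 1:]"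
    define A where "A = p 0 - smult (t\<^sup>2) (p 1) + smult (t ^ 4) (p 2)"
    define C where "C = p 6 - smult (1 / t\<^sup>2) (p 5) - smult (t\<^sup>2) (p 7)"
    define B where "B = p 3 - smult (t\<^sup>2) (p 4) - smult t (p 8)"
    have co: "coeff (p i) n = e i n t" for i
      by (simp add: p_def e_def coeff_map_poly)
    have W: "degree W = 3" using t by (simp add: W_def)
    \<comment> \<open>Because \<zeta> (\<zeta> + 3) = \<zeta>^2 + 3 \<zeta>, the part
      \<open>C\<close> also contributes three times to the coefficient of \<zeta>.\<close>
    have "pcompose A W + [:0, 1:] * pcompose (B + smult 3 C) W + [:0, 0, 1:] * pcompose C W = 0"
    proof (rule poly_eq_0_off_point[of "-1"])
      fix \<zeta> :: real assume \<zeta>: "\<zeta> \<noteq> -1"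
      have pW: "poly W \<zeta> = \<zeta>\<^sup>2 * (\<zeta> + 3) / t ^ 4"
        by (simp add: W_def power2_eq_square algebra_simps add_divide_distrib)
      have "comb332 m (- t\<^sup>2) (t ^ 3) \<zeta> (- t * \<zeta>) (- (\<zeta> * (\<zeta> + 3)) / t\<^sup>2) (\<zeta>\<^sup>2 * (\<zeta> + 3) / t ^ 4)
        = poly A (poly W \<zeta>) + \<zeta> * poly B (poly W \<zeta>) + \<zeta> * (\<zeta> + 3) * poly C (poly W \<zeta>)"
        unfolding comb332_expand pW eval2_def p_def[symmetric] A_def B_def C_def
        using t by (simp add: field_simps power2_eq_square eval_nat_numeral)
      then have "poly A (poly W \<zeta>) + \<zeta> * poly B (poly W \<zeta>) + \<zeta> * (\<zeta> + 3) * poly C (poly W \<zeta>) = 0"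
        using assms(1)[OF t \<zeta>] by simp
      then show "poly (pcompose A W + [:0, 1:] * pcompose (B + smult 3 C) W + [:0, 0, 1:] * pcompose C W) \<zeta> = 0"
        by (simp add: poly_pcompose algebra_simps)
    qed
    then have z: "A = 0 \<and> B + smult 3 C = 0 \<and> C = 0"
      by (rule pcompose_cubic_independent[OF W])
    then have "coeff A n = 0" "coeff B n = 0" "t\<^sup>2 * coeff C n = 0"
      by auto
    then show ?thesis
      using t by (simp add: A_def B_def C_def co algebra_simps power2_eq_square eval_nat_numeral)
  qed
  \<comment> \<open>The exponents 0, 2, 4 of t are distinct modulo 3. In the form required, t^4 is t
    times t^3, and the factor t^3 becomes \<open>pCons 0\<close>.\<close>
  have "coeff (m 0) n = 0 \<and> coeff (m 1) n = 0 \<and> coeff (m 2) n = 0" for n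
    using cube_residues_independent[of "coeff (m 0) n" "pCons 0 (coeff (m 2) n)" "- coeff (m 1) n"]
      main[of _ n] unfolding e_def
    by (simp add: poly_of_int_simps algebra_simps power2_eq_square eval_nat_numeral)
  moreover have "coeff (m 3) n = 0 \<and> coeff (m 8) n = 0 \<and> coeff (m 4) n = 0" for n
    using cube_residues_independent[of "coeff (m 3) n" "- coeff (m 8) n" "- coeff (m 4) n"]
      main[of _ n] unfolding e_def
    by (simp add: poly_of_int_simps algebra_simps power2_eq_square eval_nat_numeral)
  moreover have "coeff (m 5) n = 0 \<and> coeff (m 7) n = 0 \<and> coeff (m 6) n = 0" for n
    using cube_residues_independent[of "- coeff (m 5) n" "pCons 0 (- coeff (m 7) n)" "coeff (m 6) n"]
      main[of _ n] unfolding e_def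
    by (simp add: poly_of_int_simps algebra_simps power2_eq_square eval_nat_numeral)
  ultimately have "m 0 = 0" "m 1 = 0" "m 2 = 0" "m 3 = 0" "m 4 = 0" "m 5 = 0" "m 6 = 0" "m 7 = 0" "m 8 = 0"
    by (auto simp: poly_eq_iff)
  moreover have "i \<in> {0, 1, 2, 3, 4, 5, 6, 7, 8}" using i by auto
  ultimately show ?thesis by auto
qed

section \<open>Laurent polynomials in one variable and in its mutation\<close>

lemma is_subring_sum:
  assumes "is_subring R" "\<And>i. i \<in> A \<Longrightarrow> f i \<in> R"
  shows "sum f A \<in> R"
  using assms(2) by (induction A rule: infinite_finite_induct) (auto intro: is_subringD[OF assms(1)])

definition adjoin :: "'a::comm_ring_1 set \<Rightarrow> 'a \<Rightarrow> 'a set" where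
  "adjoin D b = {poly p b | p. \<forall>k. coeff p k \<in> D}"

lemma adjoin_subring:
  assumes D: "is_subring D"
  shows "is_subring (adjoin D b)"
  unfolding is_subring_def
proof (intro conjI ballI)
  have "\<forall>k. coeff 1 k \<in> D"
    using is_subringD(1,2)[OF D] by (simp add: coeff_1)
  then show "1 \<in> adjoin D b"
    unfolding adjoin_def by (intro CollectI exI[of _ 1]) simp
  fix f g assume "f \<in> adjoin D b" "g \<in> adjoin D b"
  then obtain p q where pq: "f = poly p b" "g = poly q b"
    and c: "\<And>k. coeff p k \<in> D" "\<And>k. coeff q k \<in> D"
    unfolding adjoin_def by blast
  have "coeff (p - q) k \<in> D" for k
    using is_subringD(3)[OF D] c by simp
  then show "f - g \<in> adjoin D b"
    unfolding adjoin_def pq by (intro CollectI exI[of _ "p - q"]) simp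
  have "coeff (p * q) k \<in> D" for k
    unfolding coeff_mult by (intro is_subring_sum[OF D] is_subringD(4)[OF D] c)
  then show "f * g \<in> adjoin D b"
    unfolding adjoin_def pq by (intro CollectI exI[of _ "p * q"]) simp
qed

lemma adjoin_base:
  assumes D: "is_subring D"
  shows "D \<subseteq> adjoin D b" "b \<in> adjoin D b"
proof -
  have "\<forall>k. coeff [:d:] k \<in> D" if "d \<in> D" for d
    using is_subringD(2)[OF D] that by (auto simp: coeff_pCons split: nat.split)
  then show "D \<subseteq> adjoin D b"
    unfolding adjoin_def by (force intro: exI[of _ "[:_:]"])
  have "\<forall>k. coeff [:0, 1:] k \<in> D"
    using is_subringD(1,2)[OF D] by (auto simp: coeff_pCons split: nat.split)
  then show "b \<in> adjoin D b"
    unfolding adjoin_def by (force intro: exI[of _ "[:0, 1:]"])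
qed

text \<open>Compare the expansions of \<open>f\<close> in powers of b and of b' = Q / b, where Q = b
  b'. The coefficient of a negative power b^(i-N) must carry the factor Q^(N-i), which turns the
  term into a multiple of b'^(N-i).\<close>

lemma laurent_intersection:
  fixes b b' :: "'a::field_char_0"
  assumes D: "is_subring D" and b: "b \<noteq> 0" "b' \<noteq> 0" and Q: "b * b' \<in> D"
    and trans: "\<And>P. (\<And>k. coeff P k \<in> D) \<Longrightarrow> poly P b = 0 \<Longrightarrow> P = 0"
    and f: "f * b ^ n \<in> adjoin D b" "f * b' ^ n' \<in> adjoin D b'"
  shows "f \<in> is_subring hull (D \<union> {b, b'})"
proof -
  define N where "N = n + n'"
  have "f * b ^ N = (f * b ^ n) * b ^ n'" "f * b' ^ N = (f * b' ^ n') * b' ^ n"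
    by (simp_all add: N_def power_add)
  then have "f * b ^ N \<in> adjoin D b" "f * b' ^ N \<in> adjoin D b'"
    using f adjoin_base(2)[OF D] is_subringD(4,7)[OF adjoin_subring[OF D]] by metis+
  then obtain p q where p: "f * b ^ N = poly p b" "\<And>k. coeff p k \<in> D"
    and q: "f * b' ^ N = poly q b'" "\<And>k. coeff q k \<in> D"
    unfolding adjoin_def by auto
  define Q where "Q = b * b'"
  have QD: "Q \<in> D" and Q0: "Q \<noteq> 0"
    using Q b by (auto simp: Q_def)
  define K where "K = degree q"
  \<comment> \<open>\<open>poly P b\<close> is Q^N b^(K+N) times f - f, with f expanded through
    \<open>p\<close> and through \<open>q\<close>. The factor b^K keeps all exponents
    nonnegative.\<close>
  define P where "P = smult (Q ^ N) (monom 1 K * p) - (\<Sum>j\<le>K. monom (coeff q j * Q ^ j) (K - j + 2 * N))"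
  have cP: "coeff P k = Q ^ N * (if k < K then 0 else coeff p (k - K))
      - (\<Sum>j\<le>K. if K - j + 2 * N = k then coeff q j * Q ^ j else 0)" for k
    by (simp add: P_def coeff_sum coeff_monom_mult)
  have sum_D: "(\<Sum>j\<le>K. if K - j + 2 * N = k then coeff q j * Q ^ j else 0) \<in> D" for k
    by (rule is_subring_sum[OF D]) (auto intro: is_subringD[OF D] q QD)
  have "(if k < K then 0 else coeff p (k - K)) \<in> D" for k
    using p(2) is_subringD(2)[OF D] by simp
  then have "coeff P k \<in> D" for k
    unfolding cP
    by (intro is_subringD(3)[OF D] is_subringD(4)[OF D is_subringD(7)[OF D QD]] sum_D)
  moreover have "poly P b = 0"
  proof -
    have "(\<Sum>j\<le>K. coeff q j * Q ^ j * b ^ (K - j + 2 * N)) = (\<Sum>j\<le>K. coeff q j * b' ^ j * b ^ (K + 2 * N))"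
    proof (rule sum.cong)
      fix j assume "j \<in> {..K}"
      then have "b ^ (K + 2 * N) = b ^ j * b ^ (K - j + 2 * N)"
        by (simp flip: power_add)
      then show "coeff q j * Q ^ j * b ^ (K - j + 2 * N) = coeff q j * b' ^ j * b ^ (K + 2 * N)"
        by (simp add: Q_def power_mult_distrib)
    qed simp
    also have "\<dots> = poly q b' * b ^ (K + 2 * N)"
      by (simp add: poly_altdef K_def sum_distrib_right)
    finally have "poly P b = Q ^ N * (b ^ K * poly p b) - poly q b' * b ^ (K + 2 * N)"
      by (simp add: P_def poly_sum poly_monom)
    also have "\<dots> = 0"
      by (simp add: p(1)[symmetric] q(1)[symmetric] Q_def power_add power_mult_distrib mult_2)
    finally show ?thesis .
  qed
  ultimately have "P = 0" by (rule trans)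
  \<comment> \<open>The exponents K - j + 2 N and K + i agree exactly for j = 2 N - i. If that
    exceeds the degree of \<open>q\<close>, the coefficient on the right is 0.\<close>
  have pq: "coeff p i = coeff q (2 * N - i) * Q ^ (N - i)" if i: "i < N" for i
  proof -
    have "(\<Sum>j\<le>K. if K - j + 2 * N = K + i then coeff q j * Q ^ j else 0)
        = (\<Sum>j\<le>K. if j = 2 * N - i then coeff q j * Q ^ j else 0)"
      using i by (intro sum.cong) auto
    also have "\<dots> = coeff q (2 * N - i) * Q ^ (2 * N - i)"
      by (simp add: K_def coeff_eq_0)
    finally have "coeff P (K + i) = Q ^ N * coeff p i - coeff q (2 * N - i) * Q ^ (2 * N - i)"
      by (simp add: cP)
    then have "Q ^ N * coeff p i = coeff q (2 * N - i) * Q ^ (2 * N - i)"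
      using \<open>P = 0\<close> by simp
    also have "Q ^ (2 * N - i) = Q ^ N * Q ^ (N - i)"
      using i by (simp add: mult_2 flip: power_add)
    finally show ?thesis using Q0 by simp
  qed
  let ?E = "is_subring hull (D \<union> {b, b'})"
  have base: "b \<in> ?E" "b' \<in> ?E" "\<And>d. d \<in> D \<Longrightarrow> d \<in> ?E"
    by (auto intro: hull_inc)
  have "coeff p i * b ^ i / b ^ N \<in> ?E" for i
  proof (cases "i < N")
    case True
    have "b ^ N = b ^ i * b ^ (N - i)"
      using True by (simp flip: power_add)
    then have "coeff p i * b ^ i / b ^ N = coeff q (2 * N - i) * b' ^ (N - i)"
      using b by (simp add: pq[OF True] Q_def power_mult_distrib)
    then show ?thesis
      using subring_hull_closed(4,7) base q(2) by metis
  next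
    case False
    then have "b ^ i = b ^ N * b ^ (i - N)"
      by (simp flip: power_add)
    then have "coeff p i * b ^ i / b ^ N = coeff p i * b ^ (i - N)"
      using b by simp
    then show ?thesis
      using subring_hull_closed(4,7) base p(2) by metis
  qed
  then have "(\<Sum>i\<le>degree p. coeff p i * b ^ i / b ^ N) \<in> ?E"
    by (rule is_subring_sum[OF is_subring_hull])
  moreover have "f = (\<Sum>i\<le>degree p. coeff p i * b ^ i / b ^ N)"
    using p(1) b by (simp add: poly_altdef field_simps flip: sum_divide_distrib)
  ultimately show ?thesis by simp
qed

lemma laurent_ring_adjoin:
  fixes b :: "'a::field_char_0"
  assumes D: "is_subring D" and b: "b \<noteq> 0"
    and Z: "\<And>z. z \<in> Z \<Longrightarrow> z = b \<or> z \<in> D \<and> inverse z \<in> D" and f: "f \<in> laurent_ring Z"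
  shows "\<exists>n. f * b ^ n \<in> adjoin D b"
proof -
  note R = adjoin_subring[OF D, of b] and base = adjoin_base[OF D, of b]
  have D': "z \<in> {f. \<exists>n. f * b ^ n \<in> adjoin D b}" if "z \<in> D" for z
    using that base by (auto intro!: exI[of _ 0])
  have "b * b ^ 0 \<in> adjoin D b" "inverse b * b ^ 1 \<in> adjoin D b"
    using b base is_subringD(1)[OF R] by simp_all
  then have b': "b \<in> {f. \<exists>n. f * b ^ n \<in> adjoin D b}" "inverse b \<in> {f. \<exists>n. f * b ^ n \<in> adjoin D b}"
    by blast+
  have "laurent_ring Z \<subseteq> {f. \<exists>n. f * b ^ n \<in> adjoin D b}"
  proof (rule laurent_ring_subset[OF localization_subring[OF R base(2)]])
    show "Z \<subseteq> {f. \<exists>n. f * b ^ n \<in> adjoin D b}" "inverse ` Z \<subseteq> {f. \<exists>n. f * b ^ n \<in> adjoin D b}"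
      using Z D' b' by blast+
  qed
  with f show ?thesis by blast
qed

section \<open>The seven generators\<close>

definition gen_ring :: "'a::field_char_0 ^ 3 \<Rightarrow> 'a set" where
  "gen_ring x = is_subring hull (range (gen332 x))"

text \<open>All numerators factor through w = x1 x3 z: those of y1, y2, y3 are (x1 + x3) w, w (w + 3
  x1 x3) and w^2 (w + 3 x1 x3).\<close>

lemma gen332_identities:
  fixes x :: "'a::field_char_0 ^ 3"
  assumes "x $ 1 \<noteq> 0" "x $ 2 \<noteq> 0" "x $ 3 \<noteq> 0"
  shows "x $ 1 * x $ 3 * (gen332 x Y0 - 1) = x $ 2 ^ 3 + (x $ 1)\<^sup>2 + (x $ 3)\<^sup>2 - x $ 1 * x $ 3"
    and "x $ 2 * gen332 x Y1 = (x $ 1 + x $ 3) * (gen332 x Y0 - 1)"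
    and "x $ 2 * gen332 x Y2 = (gen332 x Y0 - 1) * (gen332 x Y0 + 2)"
    and "(x $ 2)\<^sup>2 * gen332 x Y3 = (gen332 x Y0 - 1)\<^sup>2 * (gen332 x Y0 + 2)"
proof -
  define a b c where "a = x $ 1" and "b = x $ 2" and "c = x $ 3"
  note abc = a_def[symmetric] b_def[symmetric] c_def[symmetric]
  have nz: "a \<noteq> 0" "b \<noteq> 0" "c \<noteq> 0"
    using assms by (auto simp: abc)
  define w where "w = b ^ 3 + a\<^sup>2 + c\<^sup>2 - a * c"
  have z: "gen332 x Y0 - 1 = w / (a * c)" and z3: "gen332 x Y0 + 2 = (w + 3 * (a * c)) / (a * c)"
    using nz by (simp_all add: abc w_def Let_def field_simps)
  show "x $ 1 * x $ 3 * (gen332 x Y0 - 1) = x $ 2 ^ 3 + (x $ 1)\<^sup>2 + (x $ 3)\<^sup>2 - x $ 1 * x $ 3"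
    using nz by (simp only: z abc) (simp add: w_def)
  have "a * b ^ 3 + b ^ 3 * c + a ^ 3 + c ^ 3 = (a + c) * w"
    by (simp add: w_def algebra_simps power2_eq_square power3_eq_cube)
  then show "x $ 2 * gen332 x Y1 = (x $ 1 + x $ 3) * (gen332 x Y0 - 1)"
    unfolding z using nz by (simp add: abc Let_def)
  have "b ^ 6 + 2 * a\<^sup>2 * b ^ 3 + a * b ^ 3 * c + 2 * b ^ 3 * c\<^sup>2 + a ^ 4 + a ^ 3 * c + a * c ^ 3 + c ^ 4
      = w * (w + 3 * (a * c))"
    by (simp add: w_def algebra_simps eval_nat_numeral)
  then show "x $ 2 * gen332 x Y2 = (gen332 x Y0 - 1) * (gen332 x Y0 + 2)"
    unfolding z z3 using nz by (simp add: abc Let_def power2_eq_square)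
  have "b ^ 9 + 3 * a\<^sup>2 * b ^ 6 + 3 * b ^ 6 * c\<^sup>2 + 3 * a ^ 4 * b ^ 3 + 3 * a\<^sup>2 * b ^ 3 * c\<^sup>2
        + 3 * b ^ 3 * c ^ 4 + a ^ 6 + 2 * a ^ 3 * c ^ 3 + c ^ 6 = w\<^sup>2 * (w + 3 * (a * c))"
    by (simp add: w_def algebra_simps eval_nat_numeral)
  then show "(x $ 2)\<^sup>2 * gen332 x Y3 = (gen332 x Y0 - 1)\<^sup>2 * (gen332 x Y0 + 2)"
    unfolding z z3 using nz by (simp add: abc Let_def power2_eq_square power3_eq_cube ac_simps)
qed

lemma gensym_cases: "g \<in> {X1, X2, X3, Y0, Y1, Y2, Y3}"
  by (cases g) auto

text \<open>For clusters in which x2 is invertible: y1, y2, y3 are polynomials in x1, x3, y0 and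
  1/x2.\<close>

lemma gen332_mem_of_Y0_mem:
  fixes x :: "'a::field_char_0 ^ 3"
  assumes nz: "x $ 1 \<noteq> 0" "x $ 2 \<noteq> 0" "x $ 3 \<noteq> 0" and R: "is_subring R"
    and "x $ 1 \<in> R" "x $ 2 \<in> R" "x $ 3 \<in> R" "inverse (x $ 2) \<in> R" "gen332 x Y0 \<in> R"
  shows "gen332 x g \<in> R"
proof -
  have "gen332 x Y1 = (x $ 1 + x $ 3) * (gen332 x Y0 - 1) * inverse (x $ 2)"
    "gen332 x Y2 = (gen332 x Y0 - 1) * (gen332 x Y0 + 2) * inverse (x $ 2)"
    "gen332 x Y3 = (gen332 x Y0 - 1)\<^sup>2 * (gen332 x Y0 + 2) * inverse (x $ 2) ^ 2"
    unfolding gen332_identities(2-4)[OF nz, symmetric] using nz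
    by (simp_all add: field_simps del: gen332.simps)
  moreover have "(x $ 1 + x $ 3) * (gen332 x Y0 - 1) * inverse (x $ 2) \<in> R"
    "(gen332 x Y0 - 1) * (gen332 x Y0 + 2) * inverse (x $ 2) \<in> R"
    "(gen332 x Y0 - 1)\<^sup>2 * (gen332 x Y0 + 2) * inverse (x $ 2) ^ 2 \<in> R"
    by (rule assms is_subringD[OF R])+
  ultimately have "gen332 x Y1 \<in> R" "gen332 x Y2 \<in> R" "gen332 x Y3 \<in> R"
    by metis+
  then show ?thesis
    using gensym_cases[of g] assms(5-9) by (auto simp del: gen332.simps(4-7))
qed

text \<open>For the initial cluster and its mutation at 2. At x2 = 0 the numerators of y1, y2, y3
  are divisible by x1^3 + x3^3, twice in the case of y3, and x1^3 + x3^3 = x2 x2', so the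
  denominators x2 and x2^2 cancel.\<close>

lemma gen332_mem_of_mutation_2_mem:
  fixes x :: "'a::field_char_0 ^ 3"
  assumes nz: "x $ 1 \<noteq> 0" "x $ 2 \<noteq> 0" "x $ 3 \<noteq> 0" and R: "is_subring R"
    and "x $ 1 \<in> R" "x $ 2 \<in> R" "x $ 3 \<in> R" "inverse (x $ 1) \<in> R" "inverse (x $ 3) \<in> R"
    and "(x $ 1 ^ 3 + x $ 3 ^ 3) / x $ 2 \<in> R"
  shows "gen332 x g \<in> R"
proof -
  define a b c u where "a = x $ 1" and "b = x $ 2" and "c = x $ 3" and "u = (a ^ 3 + c ^ 3) / b"
  note abc = a_def[symmetric] b_def[symmetric] c_def[symmetric]
  have mem: "a \<in> R" "b \<in> R" "c \<in> R" "inverse a \<in> R" "inverse c \<in> R" "u \<in> R" and nz: "a \<noteq> 0" "b \<noteq> 0" "c \<noteq> 0"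
    using assms by (auto simp: abc u_def)
  have u: "a ^ 3 + c ^ 3 = u * b"
    using nz by (simp add: u_def)
  have "gen332 x Y0 = (b ^ 3 + a\<^sup>2 + c\<^sup>2) * inverse a * inverse c"
    using nz by (simp add: abc Let_def field_simps)
  moreover have "gen332 x Y1 = (b ^ 2 * (a + c) + u) * inverse a * inverse c"
  proof -
    have "a * b ^ 3 + b ^ 3 * c + a ^ 3 + c ^ 3 = b * (b ^ 2 * (a + c)) + (a ^ 3 + c ^ 3)"
      by (simp add: algebra_simps eval_nat_numeral)
    also have "\<dots> = b * (b ^ 2 * (a + c) + u)"
      unfolding u by (simp add: algebra_simps)
    finally show ?thesis
      using nz by (simp add: abc Let_def divide_inverse)
  qed
  moreover have "gen332 x Y2 = (b ^ 5 + 2 * a\<^sup>2 * b\<^sup>2 + a * b\<^sup>2 * c + 2 * b\<^sup>2 * c\<^sup>2 + u * (a + c))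
      * inverse a ^ 2 * inverse c ^ 2"
  proof -
    have "b ^ 6 + 2 * a\<^sup>2 * b ^ 3 + a * b ^ 3 * c + 2 * b ^ 3 * c\<^sup>2 + a ^ 4 + a ^ 3 * c + a * c ^ 3 + c ^ 4
        = b * (b ^ 5 + 2 * a\<^sup>2 * b\<^sup>2 + a * b\<^sup>2 * c + 2 * b\<^sup>2 * c\<^sup>2) + (a ^ 3 + c ^ 3) * (a + c)"
      by (simp add: algebra_simps eval_nat_numeral)
    also have "\<dots> = b * (b ^ 5 + 2 * a\<^sup>2 * b\<^sup>2 + a * b\<^sup>2 * c + 2 * b\<^sup>2 * c\<^sup>2 + u * (a + c))"
      unfolding u by (simp add: algebra_simps)
    finally show ?thesis
      using nz by (simp add: abc Let_def divide_inverse power_mult_distrib power_inverse)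
  qed
  moreover have "gen332 x Y3 = (b ^ 7 + 3 * a\<^sup>2 * b ^ 4 + 3 * b ^ 4 * c\<^sup>2 + 3 * a ^ 4 * b + 3 * a\<^sup>2 * b * c\<^sup>2
        + 3 * b * c ^ 4 + u ^ 2) * inverse a ^ 3 * inverse c ^ 3"
  proof -
    have "b ^ 9 + 3 * a\<^sup>2 * b ^ 6 + 3 * b ^ 6 * c\<^sup>2 + 3 * a ^ 4 * b ^ 3 + 3 * a\<^sup>2 * b ^ 3 * c\<^sup>2
        + 3 * b ^ 3 * c ^ 4 + a ^ 6 + 2 * a ^ 3 * c ^ 3 + c ^ 6
      = b ^ 2 * (b ^ 7 + 3 * a\<^sup>2 * b ^ 4 + 3 * b ^ 4 * c\<^sup>2 + 3 * a ^ 4 * b + 3 * a\<^sup>2 * b * c\<^sup>2 + 3 * b * c ^ 4)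
        + (a ^ 3 + c ^ 3) ^ 2"
      by (simp add: algebra_simps eval_nat_numeral)
    also have "\<dots> = b ^ 2 * (b ^ 7 + 3 * a\<^sup>2 * b ^ 4 + 3 * b ^ 4 * c\<^sup>2 + 3 * a ^ 4 * b + 3 * a\<^sup>2 * b * c\<^sup>2
        + 3 * b * c ^ 4 + u ^ 2)"
      unfolding u by (simp add: algebra_simps power2_eq_square)
    finally show ?thesis
      using nz by (simp add: abc Let_def divide_inverse power_mult_distrib power_inverse)
  qed
  moreover have "(b ^ 3 + a\<^sup>2 + c\<^sup>2) * inverse a * inverse c \<in> R"
    "(b ^ 2 * (a + c) + u) * inverse a * inverse c \<in> R"
    "(b ^ 5 + 2 * a\<^sup>2 * b\<^sup>2 + a * b\<^sup>2 * c + 2 * b\<^sup>2 * c\<^sup>2 + u * (a + c)) * inverse a ^ 2 * inverse c ^ 2 \<in> R"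
    "(b ^ 7 + 3 * a\<^sup>2 * b ^ 4 + 3 * b ^ 4 * c\<^sup>2 + 3 * a ^ 4 * b + 3 * a\<^sup>2 * b * c\<^sup>2
        + 3 * b * c ^ 4 + u ^ 2) * inverse a ^ 3 * inverse c ^ 3 \<in> R"
    by (rule mem is_subringD[OF R])+
  ultimately have "gen332 x Y0 \<in> R" "gen332 x Y1 \<in> R" "gen332 x Y2 \<in> R" "gen332 x Y3 \<in> R"
    by metis+
  then show ?thesis
    using gensym_cases[of g] assms(5-7) by (auto simp del: gen332.simps(4-7))
qed

text \<open>For changes of variables that undo themselves: substituting y for x turns y back into x,
  and hence a relation between the y into one between the x. Mutation at 1 and the exchange of x1
  and x3 are of this kind.\<close>

lemma alg_indep_transfer:
  assumes x: "alg_indep x" and y: "\<And>i. specializes x y (y i) (x i)"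
  shows "alg_indep y"
  unfolding alg_indep_def
proof (intro allI impI)
  fix P assume "mpol_eval of_int y P = 0"
  then have "mpol_eval of_int x P = 0"
    using specializes_mpol_eval[of x y y x P] y specializes_0D[OF x] by fastforce
  then show "P = 0"
    using x unfolding alg_indep_def by blast
qed

section \<open>The relations, and specialization at x1 = 0\<close>

context
  fixes x :: "'a::field_char_0 ^ 3"
  assumes free: "alg_indep (($) x)"
begin

lemma alg_indep_nonzero:
  "x $ i \<noteq> 0" "0 < m \<Longrightarrow> x $ i ^ m + x $ j ^ n \<noteq> 0"
proof -
  define S where "S = {f. \<exists>v :: rat. 0 < v \<and> specializes (($) x) (\<lambda>_. 1) f v}"
  have S: "positive_set S"
    unfolding S_def by (rule positive_set_specializes[OF free])
  have xS: "x $ i \<in> S" for i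
    using specializes_var[of "($) x" "\<lambda>_. 1" i] zero_less_one unfolding S_def by blast
  show "x $ i \<noteq> 0" "0 < m \<Longrightarrow> x $ i ^ m + x $ j ^ n \<noteq> 0"
    using S xS positive_set_power[OF S xS] unfolding positive_set_def by metis+
qed

lemma gen332_relations_hold:
  assumes "r \<in> relations332"
  shows "mpol_eval of_int (gen332 x) r = 0"
proof -
  define a b c z y1 y2 y3 where "a = x $ 1" and "b = x $ 2" and "c = x $ 3"
    and "z = gen332 x Y0 - 1" and "y1 = gen332 x Y1" and "y2 = gen332 x Y2" and "y3 = gen332 x Y3"
  note defs = a_def b_def c_def y1_def y2_def y3_def
  have y0: "gen332 x Y0 = z + 1" by (simp add: z_def)
  have b: "b \<noteq> 0"
    unfolding b_def by (rule alg_indep_nonzero)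
  note id = gen332_identities[OF alg_indep_nonzero(1) alg_indep_nonzero(1) alg_indep_nonzero(1), folded defs z_def]
  have h: "a * c * z = b ^ 3 + a\<^sup>2 + c\<^sup>2 - a * c" "b * y1 = (a + c) * z" "b * y2 = z * (z + 3)"
    "b\<^sup>2 * y3 = z\<^sup>2 * (z + 3)"
    using id by (simp_all add: y0 add.commute del: gen332.simps)
  \<comment> \<open>Where needed, a power of x2 is multiplied in, so that \<open>h\<close> applies
    to x2 y1, x2 y2 and x2^2 y3, and is then cancelled.\<close>
  have "b\<^sup>2 * (y2\<^sup>2 - ((z + 1) * y3 + 2 * y3)) = 0" using h by algebra
  then have 1: "y2\<^sup>2 - ((z + 1) * y3 + 2 * y3) = 0" using b by simp
  have 2: "(z + 1)\<^sup>2 - (b * y2 - (z + 1) + 2) = 0" using h by algebra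
  have "b\<^sup>2 * (y1 * y2 - (a * y3 + c * y3)) = 0" using h by algebra
  then have 3: "y1 * y2 - (a * y3 + c * y3) = 0" using b by simp
  have "b * ((z + 1) * y2 - (b * y3 + y2)) = 0" using h by algebra
  then have 4: "(z + 1) * y2 - (b * y3 + y2) = 0" using b by simp
  have "b * ((z + 1) * y1 - (a * y2 + c * y2 - 2 * y1)) = 0" using h by algebra
  then have 5: "(z + 1) * y1 - (a * y2 + c * y2 - 2 * y1) = 0" using b by simp
  have 6: "(a * (z + 1) + c * (z + 1)) - (b * y1 + a + c) = 0" using h by algebra
  have "b\<^sup>2 * (b\<^sup>2 * y2 - (a * c * y3 + 3 * b * (z + 1) - y1\<^sup>2 - 3 * b)) = 0" using h by algebra
  then have 7: "b\<^sup>2 * y2 - (a * c * y3 + 3 * b * (z + 1) - y1\<^sup>2 - 3 * b) = 0" using b by simp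
  have "b * (b\<^sup>2 * (z + 1) - (a * c * y2 + b\<^sup>2 - a * y1 - c * y1)) = 0" using h by algebra
  then have 8: "b\<^sup>2 * (z + 1) - (a * c * y2 + b\<^sup>2 - a * y1 - c * y1) = 0" using b by simp
  have 9: "(b ^ 3 + c\<^sup>2 * (z + 1)) - (b * c * y1 - a\<^sup>2 + a * c) = 0" using h by algebra
  from assms show ?thesis
    unfolding relations332_def Let_def
    by (elim insertE emptyE; hypsubst)
      (simp_all only: of_int_coeff.mpol_eval_simps gen332.simps(1-3) y0 defs[symmetric] 1 2 3 4 5 6 7 8 9)
qed

lemma ideal_hull_relations332_eval:
  assumes "r \<in> is_ideal hull relations332"
  shows "mpol_eval of_int (gen332 x) r = 0"
proof -
  have "is_ideal {r. mpol_eval of_int (gen332 x) r = 0}"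
    by (simp add: is_ideal_def of_int_coeff.mpol_eval_simps)
  then have "is_ideal hull relations332 \<subseteq> {r. mpol_eval of_int (gen332 x) r = 0}"
    by (rule hull_minimal[rotated]) (use gen332_relations_hold in blast)
  with assms show ?thesis by blast
qed

text \<open>Specialize \<open>(x\<^sub>1', x\<^sub>2, x\<^sub>3)\<close> to \<open>(t\<^sup>3 (\<zeta> + 1), - t\<^sup>2, t\<^sup>3)\<close>: then \<open>x\<^sub>1\<close> becomes \<open>0\<close>.\<close>

lemma comb332_divisible:
  assumes g: "g \<in> laurent_ring {(x $ 2 ^ 3 + x $ 3 ^ 2) / x $ 1, x $ 2, x $ 3}"
    and eq: "comb332 m (x $ 2) (x $ 3) (gen332 x Y0 - 1) (gen332 x Y1) (gen332 x Y2) (gen332 x Y3) = x $ 1 * g"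
    and i: "i < 9"
  shows "m i = 0"
proof (rule comb332_independent[OF _ i])
  fix t \<zeta> :: real
  assume t: "t \<noteq> 0" and \<zeta>: "\<zeta> \<noteq> -1"
  define a b c u where "a = x $ 1" and "b = x $ 2" and "c = x $ 3" and "u = (b ^ 3 + c ^ 2) / a"
  note abc = a_def[symmetric] b_def[symmetric] c_def[symmetric]
  have nz: "a \<noteq> 0" "b \<noteq> 0" "c \<noteq> 0" "u \<noteq> 0"
    using alg_indep_nonzero(2)[of 3 2 3 2] by (simp_all add: a_def b_def c_def u_def alg_indep_nonzero(1))
  have a: "a = (b ^ 3 + c ^ 2) / u"
    using nz by (simp add: u_def)
  \<comment> \<open>The coordinates are changed to the cluster mutated at 1, where the point at
    which \<open>a\<close> vanishes can be expressed with nonzero coordinates.\<close>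
  define x' :: "3 \<Rightarrow> 'a" where "x' i = (if i = 1 then u else x $ i)" for i
  have x': "x' 1 = u" "x' 2 = b" "x' 3 = c" by (simp_all add: x'_def b_def c_def)
  have "specializes (($) x) x' (x' i) (x $ i)" for i
  proof (cases "i = 1")
    case True
    have "specializes (($) x) x' a u" "specializes (($) x) x' b b" "specializes (($) x) x' c c"
      using specializes_var[of "($) x" x'] x' by (metis a_def, metis b_def, metis c_def)
    then have "specializes (($) x) x' ((b ^ 3 + c ^ 2) / a) ((b ^ 3 + c ^ 2) / u)"
      using nz(4) by (intro specializes_divide[OF free] specializes_add specializes_power)
    then have "specializes (($) x) x' u a"
      unfolding u_def[symmetric] a[symmetric] .
    then show ?thesis
      using True by (simp add: x' a_def)
  next
    case False
    then show ?thesis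
      using specializes_var[of "($) x" x' i] by (simp add: x'_def)
  qed
  then have free': "alg_indep x'"
    by (rule alg_indep_transfer[OF free])
  \<comment> \<open>The pair (-t^2, t^3) parametrizes the cuspidal curve x2^3 + x3^2 = 0, so the
    numerator of \<open>a\<close> vanishes. Since y0 = (u + a) / c, the first coordinate is chosen
    to give y0 the value \<zeta> + 1.\<close>
  define p :: "3 \<Rightarrow> real" where "p i = (if i = 1 then t ^ 3 * (\<zeta> + 1) else if i = 2 then - t\<^sup>2 else t ^ 3)" for i
  have su: "specializes x' p u (t ^ 3 * (\<zeta> + 1))" and sb: "specializes x' p b (- t\<^sup>2)"
    and sc: "specializes x' p c (t ^ 3)"
    using specializes_var[of x' p 1] specializes_var[of x' p 2] specializes_var[of x' p 3]
    by (simp_all add: x' p_def)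
  have pnz: "t ^ 3 * (\<zeta> + 1) \<noteq> 0" "- t\<^sup>2 \<noteq> 0" "t ^ 3 \<noteq> 0"
    using t \<zeta> by auto
  note sp = specializes_add specializes_diff specializes_mult specializes_power specializes_1 specializes_numeral
    su sb sc
  have "specializes x' p ((b ^ 3 + c ^ 2) / u) (((- t\<^sup>2) ^ 3 + (t ^ 3) ^ 2) / (t ^ 3 * (\<zeta> + 1)))"
    by (intro specializes_divide[OF free'] sp pnz)
  then have sa: "specializes x' p a 0"
    by (simp add: a[symmetric])
  have "gen332 x Y0 - 1 = (u + a) / c - 1"
    using nz by (simp add: Let_def abc u_def field_simps power2_eq_square)
  moreover have "specializes x' p ((u + a) / c - 1) ((t ^ 3 * (\<zeta> + 1) + 0) / t ^ 3 - 1)"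
    by (intro specializes_divide[OF free'] sp sa pnz)
  ultimately have sz: "specializes x' p (gen332 x Y0 - 1) \<zeta>"
    using t by simp
  note id = gen332_identities(2-4)[OF alg_indep_nonzero(1) alg_indep_nonzero(1) alg_indep_nonzero(1)]
  define z where "z = gen332 x Y0 - 1"
  have y0: "gen332 x Y0 = z + 1" by (simp add: z_def)
  have y: "gen332 x Y1 = (a + c) * z / b" "gen332 x Y2 = z * (z + 3) / b" "gen332 x Y3 = z\<^sup>2 * (z + 3) / b\<^sup>2"
    using id nz unfolding abc y0 by (simp_all add: field_simps del: gen332.simps)
  have z: "specializes x' p z \<zeta>"
    unfolding z_def by (rule sz)
  have "specializes x' p ((a + c) * z / b) ((0 + t ^ 3) * \<zeta> / (- t\<^sup>2))"
    by (intro specializes_divide[OF free'] sp sa z pnz)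
  moreover have "(0 + t ^ 3) * \<zeta> / (- t\<^sup>2) = - t * \<zeta>"
    using t by (simp add: power2_eq_square power3_eq_cube)
  ultimately have s1: "specializes x' p (gen332 x Y1) (- t * \<zeta>)"
    unfolding y by metis
  have "specializes x' p (z * (z + 3) / b) (\<zeta> * (\<zeta> + 3) / (- t\<^sup>2))"
    by (intro specializes_divide[OF free'] sp z pnz)
  then have s2: "specializes x' p (gen332 x Y2) (- (\<zeta> * (\<zeta> + 3)) / t\<^sup>2)"
    unfolding y by simp
  have "specializes x' p (z\<^sup>2 * (z + 3) / b\<^sup>2) (\<zeta>\<^sup>2 * (\<zeta> + 3) / (- t\<^sup>2)\<^sup>2)"
    using t by (intro specializes_divide[OF free'] sp z) simp
  then have s3: "specializes x' p (gen332 x Y3) (\<zeta>\<^sup>2 * (\<zeta> + 3) / t ^ 4)"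
    unfolding y by simp
  have "specializes x' p (comb332 m b c z (gen332 x Y1) (gen332 x Y2) (gen332 x Y3))
     (comb332 m (- t\<^sup>2) (t ^ 3) \<zeta> (- t * \<zeta>) (- (\<zeta> * (\<zeta> + 3)) / t\<^sup>2) (\<zeta>\<^sup>2 * (\<zeta> + 3) / t ^ 4))"
    unfolding comb332_expand
    by (intro specializes_add specializes_mult specializes_power specializes_eval2 sb sc z s1 s2 s3)
  \<comment> \<open>Nonzero values of \<open>u\<close>, \<open>b\<close>, \<open>c\<close> give
    \<open>g\<close> some value; which one does not matter, as it gets multiplied by the value 0 of
    \<open>a\<close>.\<close>
  moreover have "\<exists>w. w \<noteq> 0 \<and> specializes x' p y w" if "y \<in> {u, b, c}" for y
    using that su sb sc pnz by blast
  then obtain w where "specializes x' p g w"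
    using specializes_laurent_ring[OF free' _ g[unfolded abc u_def[symmetric]]] by blast
  then have "specializes x' p (a * g) (0 * w)"
    by (rule specializes_mult[OF sa])
  ultimately show "comb332 m (- t\<^sup>2) (t ^ 3) \<zeta> (- t * \<zeta>) (- (\<zeta> * (\<zeta> + 3)) / t\<^sup>2) (\<zeta>\<^sup>2 * (\<zeta> + 3) / t ^ 4) = 0"
    using specializes_unique[OF free'] eq unfolding abc z_def by (metis mult_zero_left)
qed

end

section \<open>Division by x1 and the kernel\<close>

interpretation mpol: relations332_ring "mvar X1" "mvar X2" "mvar X3" "mvar Y0" "mvar Y1" "mvar Y2" "mvar Y3"
    "mvar Y0 - 1" "is_ideal hull relations332"
  by unfold_locales (auto intro!: is_ideal_hull hull_inc simp: relations332_def Let_def)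

text \<open>The polynomials that multiply \<open>mpol.T\<close> into itself form a subring
  containing every variable, hence everything; apply this to 1.\<close>

lemma mpol_T_UNIV: "p \<in> mpol.T"
proof -
  have "p \<in> {p. \<forall>q \<in> mpol.T. p * q \<in> mpol.T}"
  proof (rule mpol_in_subring)
    show "is_subring {p. \<forall>q \<in> mpol.T. p * q \<in> mpol.T}"
      by (auto simp: is_subring_def left_diff_distrib mult.assoc intro: mpol.T_diff)
    show "mvar v \<in> {p. \<forall>q \<in> mpol.T. p * q \<in> mpol.T}" for v
      using mpol.T_mult[of "mvar v"] by (cases v) auto
  qed
  then have "p * 1 \<in> mpol.T"
    using mpol.T_basis_elems(1) by blast
  then show ?thesis by simp
qed

lemma mpol_eval_comb332:
  "mpol_eval of_int f (comb332 m x2 x3 z y1 y2 y3) =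
     comb332 m (mpol_eval of_int f x2) (mpol_eval of_int f x3) (mpol_eval of_int f z)
       (mpol_eval of_int f y1) (mpol_eval of_int f y2) (mpol_eval of_int f y3)"
  by (simp add: comb332_expand of_int_coeff.mpol_eval_simps mpol_eval_eval2)

context
  fixes x :: "'a::field_char_0 ^ 3"
  assumes free: "alg_indep (($) x)"
begin

lemma gen_ring_subset_laurent_1:
  "gen_ring x \<subseteq> laurent_ring {(x $ 2 ^ 3 + x $ 3 ^ 2) / x $ 1, x $ 2, x $ 3}"
proof -
  define a b c u where "a = x $ 1" and "b = x $ 2" and "c = x $ 3" and "u = (b ^ 3 + c ^ 2) / a"
  note abc = a_def[symmetric] b_def[symmetric] c_def[symmetric]
  have nz: "a \<noteq> 0" "b \<noteq> 0" "c \<noteq> 0" "u \<noteq> 0"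
    using alg_indep_nonzero(2)[OF free, of 3 2 3 2]
    by (simp_all add: a_def b_def c_def u_def alg_indep_nonzero(1)[OF free])
  let ?R = "laurent_ring {u, b, c}"
  have base: "u \<in> ?R" "b \<in> ?R" "c \<in> ?R" "inverse u \<in> ?R" "inverse b \<in> ?R" "inverse c \<in> ?R"
    by (auto intro: laurent_ring_base)
  have "(b ^ 3 + c ^ 2) * inverse u \<in> ?R"
    by (rule base laurent_ring_closed)+
  moreover have "(b ^ 3 + c ^ 2) * inverse u = a"
    using nz by (simp add: u_def)
  ultimately have aR: "a \<in> ?R" by simp
  have "(u + a) * inverse c \<in> ?R"
    by (rule base aR laurent_ring_closed)+
  moreover have "(u + a) * inverse c = gen332 x Y0"
    using nz by (simp add: Let_def abc u_def field_simps power2_eq_square)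
  ultimately have "gen332 x Y0 \<in> ?R" by simp
  then have "gen332 x g \<in> ?R" for g
    using gen332_mem_of_Y0_mem[of x ?R g] nz base aR is_subring_laurent_ring
    unfolding a_def b_def c_def by blast
  then show ?thesis
    unfolding gen_ring_def abc u_def[symmetric]
    by (intro subring_hull_subset is_subring_laurent_ring) blast
qed

text \<open>Write x1 g as a combination plus x1 times the value of some \<open>p\<close>. The
  combination is then x1 times an element of the same Laurent ring, so its coefficients vanish and
  \<open>g\<close> is the value of \<open>p\<close>.\<close>

lemma gen_ring_divide_1:
  assumes g: "g \<in> laurent_ring {(x $ 2 ^ 3 + x $ 3 ^ 2) / x $ 1, x $ 2, x $ 3}"
    and ag: "x $ 1 * g \<in> gen_ring x"
  shows "g \<in> gen_ring x"
proof -
  let ?ev = "mpol_eval of_int (gen332 x)"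
  have a: "x $ 1 \<noteq> 0"
    by (rule alg_indep_nonzero[OF free])
  obtain P where P: "x $ 1 * g = ?ev P"
    using ag unfolding gen_ring_def range_mpol_eval[symmetric] by blast
  have ev: "?ev Q \<in> gen_ring x" for Q
    unfolding gen_ring_def range_mpol_eval[symmetric] by blast
  show ?thesis
    using mpol_T_UNIV[of P]
  proof cases
    case zero
    then have "g = ?ev 0"
      using P a by (simp add: of_int_coeff.mpol_eval_simps)
    then show ?thesis using ev by simp
  next
    case (step p r m)
    let ?c = "comb332 m (x $ 2) (x $ 3) (gen332 x Y0 - 1) (gen332 x Y1) (gen332 x Y2) (gen332 x Y3)"
    have eq: "x $ 1 * g = ?c + x $ 1 * ?ev p"
      unfolding P step
      by (simp add: of_int_coeff.mpol_eval_simps mpol_eval_comb332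
          ideal_hull_relations332_eval[OF free step(3)] del: gen332.simps(4-7))
    have "g - ?ev p \<in> laurent_ring {(x $ 2 ^ 3 + x $ 3 ^ 2) / x $ 1, x $ 2, x $ 3}"
      using g ev gen_ring_subset_laurent_1 by (blast intro: laurent_ring_closed(3))
    moreover have "?c = x $ 1 * (g - ?ev p)"
      using eq by (simp add: algebra_simps del: gen332.simps)
    ultimately have "m i = 0" if "i < 9" for i
      using comb332_divisible[OF free] that by blast
    then have "?c = 0"
      by (simp add: comb332_def eval2_simps)
    then have "g = ?ev p"
      using eq a by simp
    then show ?thesis using ev by simp
  qed
qed

text \<open>The same argument with value 0 removes the combination; then x1 cancels in the field and
  the value of \<open>p\<close> is 0 as well, so the induction on \<open>mpol.T\<close>
  continues.\<close>

lemma mpol_eval_gen332_eq_0: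
  assumes "mpol_eval of_int (gen332 x) P = 0"
  shows "P \<in> is_ideal hull relations332"
  using mpol_T_UNIV[of P] assms
proof induction
  case zero
  show ?case by (rule is_idealD(1)[OF is_ideal_hull])
next
  case (step p r m)
  let ?ev = "mpol_eval of_int (gen332 x)"
  let ?c = "comb332 m (x $ 2) (x $ 3) (gen332 x Y0 - 1) (gen332 x Y1) (gen332 x Y2) (gen332 x Y3)"
  have eq: "?c + x $ 1 * ?ev p = 0"
    using step.prems
    by (simp add: of_int_coeff.mpol_eval_simps mpol_eval_comb332
        ideal_hull_relations332_eval[OF free step.hyps(2)] del: gen332.simps(4-7))
  have "?ev p \<in> gen_ring x"
    unfolding gen_ring_def range_mpol_eval[symmetric] by blast
  then have "- ?ev p \<in> laurent_ring {(x $ 2 ^ 3 + x $ 3 ^ 2) / x $ 1, x $ 2, x $ 3}"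
    using gen_ring_subset_laurent_1 laurent_ring_closed(5) by blast
  moreover have "?c = x $ 1 * - ?ev p"
    using eq by (simp add: eq_neg_iff_add_eq_0 del: gen332.simps)
  ultimately have m: "m i = 0" if "i < 9" for i
    using comb332_divisible[OF free] that by blast
  then have "?c = 0"
    by (simp add: comb332_def eval2_simps)
  then have "?ev p = 0"
    using eq alg_indep_nonzero[OF free] by simp
  moreover have "mpol.comb m = 0"
    using m by (simp add: comb332_def eval2_simps)
  ultimately show ?case
    using step.IH step.hyps(2) is_idealD[OF is_ideal_hull] by (metis add_0)
qed

end

section \<open>Exchange of x1 and x3\<close>

text \<open>The generators y0 to y3 are symmetric in x1 and x3, which turns every statement about
  the mutation at 1 into one about the mutation at 3.\<close>

definition reverse3 :: "'a::zero ^ 3 \<Rightarrow> 'a ^ 3" where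
  "reverse3 x = vector [x $ 3, x $ 2, x $ 1]"

lemma alg_indep_reverse3:
  fixes x :: "'a::field_char_0 ^ 3"
  assumes "alg_indep (($) x)"
  shows "alg_indep (($) (reverse3 x))"
proof (rule alg_indep_transfer[OF assms])
  fix i :: 3
  show "specializes (($) x) (($) (reverse3 x)) (reverse3 x $ i) (x $ i)"
    using exhaust_3[of i] specializes_var[of "($) x" "($) (reverse3 x)"]
    by (elim disjE; hypsubst) (metis (no_types) reverse3_def vector_3)+
qed

lemma gen_ring_reverse3: "gen_ring (reverse3 x) = gen_ring x"
proof -
  have "gen332 (reverse3 x) X1 = gen332 x X3" "gen332 (reverse3 x) X2 = gen332 x X2"
    "gen332 (reverse3 x) X3 = gen332 x X1" "gen332 (reverse3 x) Y0 = gen332 x Y0"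
    "gen332 (reverse3 x) Y1 = gen332 x Y1" "gen332 (reverse3 x) Y2 = gen332 x Y2"
    "gen332 (reverse3 x) Y3 = gen332 x Y3"
    by (simp_all add: reverse3_def Let_def algebra_simps)
  note eqs = this
  have range: "range f = {f X1, f X2, f X3, f Y0, f Y1, f Y2, f Y3}" for f :: "gensym \<Rightarrow> 'a"
  proof -
    have "UNIV = {X1, X2, X3, Y0, Y1, Y2, Y3}"
      by (rule UNIV_eq_I) (rule gensym_cases)
    then show ?thesis by (simp only: \<open>UNIV = _\<close> image_insert image_empty)
  qed
  have "{a, b, c, d, e, f, g} = {c, b, a, d, e, f, g}" for a b c d e f g :: 'a
    by blast
  then show ?thesis
    unfolding gen_ring_def range eqs by (rule arg_cong)
qed

lemma gen_ring_closed_gen: "gen332 x g \<in> gen_ring x"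
  unfolding gen_ring_def by (rule hull_inc) blast

context
  fixes x :: "'a::field_char_0 ^ 3"
  assumes free: "alg_indep (($) x)"
begin

lemma gen_ring_divide_1_power:
  assumes g: "g \<in> laurent_ring {(x $ 2 ^ 3 + x $ 3 ^ 2) / x $ 1, x $ 2, x $ 3}"
    and ag: "x $ 1 ^ n * g \<in> gen_ring x"
  shows "g \<in> gen_ring x"
  using ag
proof (induction n)
  case (Suc n)
  have "x $ 1 ^ n * g \<in> laurent_ring {(x $ 2 ^ 3 + x $ 3 ^ 2) / x $ 1, x $ 2, x $ 3}"
    using gen_ring_subset_laurent_1[OF free] gen_ring_closed_gen[of x X1] g
    by (auto intro!: laurent_ring_closed(4,7))
  moreover have "x $ 1 * (x $ 1 ^ n * g) \<in> gen_ring x"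
    using Suc.prems by (simp add: mult.assoc)
  ultimately have "x $ 1 ^ n * g \<in> gen_ring x"
    by (rule gen_ring_divide_1[OF free])
  then show ?case by (rule Suc.IH)
qed simp

end

lemma gen_ring_divide_3_power:
  fixes x :: "'a::field_char_0 ^ 3"
  assumes free: "alg_indep (($) x)" and g: "g \<in> laurent_ring {(x $ 1 ^ 2 + x $ 2 ^ 3) / x $ 3, x $ 1, x $ 2}"
    and ag: "x $ 3 ^ n * g \<in> gen_ring x"
  shows "g \<in> gen_ring x"
proof -
  have r: "reverse3 x $ 1 = x $ 3" "reverse3 x $ 2 = x $ 2" "reverse3 x $ 3 = x $ 1"
    by (simp_all add: reverse3_def)
  have "{(x $ 1 ^ 2 + x $ 2 ^ 3) / x $ 3, x $ 1, x $ 2} = {(x $ 2 ^ 3 + x $ 1 ^ 2) / x $ 3, x $ 2, x $ 1}"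
    by (simp add: insert_commute add.commute)
  with gen_ring_divide_1_power[OF alg_indep_reverse3[OF free], of g n] g ag show ?thesis
    by (simp add: r gen_ring_reverse3)
qed

section \<open>Comparison with the upper cluster algebra\<close>

context
  fixes x :: "'a::field_char_0 ^ 3"
  assumes free: "alg_indep (($) x)"
begin

text \<open>Over D = Z[x1, x3, 1/x1, 1/x3], \<open>laurent_intersection\<close> puts f into
  D[x2, x2']. The element x2' lies in the ring of the generators, so only x1 and x3 remain as
  denominators.\<close>

lemma laurent_ring_intersection_gen_ring:
  assumes f: "f \<in> laurent_ring {x $ 1, x $ 2, x $ 3}"
    "f \<in> laurent_ring {(x $ 1 ^ 3 + x $ 3 ^ 3) / x $ 2, x $ 1, x $ 3}"
  shows "\<exists>N. f * (x $ 1 * x $ 3) ^ N \<in> gen_ring x"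
proof -
  define a b c b' where "a = x $ 1" and "b = x $ 2" and "c = x $ 3" and "b' = (a ^ 3 + c ^ 3) / b"
  note abc = a_def[symmetric] b_def[symmetric] c_def[symmetric]
  have nz: "a \<noteq> 0" "b \<noteq> 0" "c \<noteq> 0" "b' \<noteq> 0"
    using alg_indep_nonzero(2)[OF free, of 3 1 3 3]
    by (simp_all add: a_def b_def c_def b'_def alg_indep_nonzero(1)[OF free])
  define D where "D = is_subring hull {a, c, inverse a, inverse c}"
  have D: "is_subring D"
    unfolding D_def by (rule is_subring_hull)
  have base: "a \<in> D" "c \<in> D" "inverse a \<in> D" "inverse c \<in> D"
    unfolding D_def by (auto intro: hull_inc)
  \<comment> \<open>Transcendence of x2 over \<open>D\<close>: sending x2 to an arbitrary field
    element r fixes \<open>D\<close> pointwise, so a polynomial over \<open>D\<close> that vanishes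
    at x2 vanishes at every r.\<close>
  have trans: "P = 0" if P: "\<And>k. coeff P k \<in> D" and P0: "poly P b = 0" for P
  proof -
    have "poly P r = 0" for r
    proof -
      define p :: "3 \<Rightarrow> 'a" where "p i = (if i = 2 then r else x $ i)" for i
      have s: "specializes (($) x) p a a" "specializes (($) x) p b r" "specializes (($) x) p c c"
        using specializes_var[of "($) x" p 1] specializes_var[of "($) x" p 2] specializes_var[of "($) x" p 3]
        by (simp_all add: p_def abc)
      have "is_subring {d. specializes (($) x) p d d}"
        by (auto simp: is_subring_def intro: specializes_1 specializes_diff specializes_mult)
      then have "D \<subseteq> {d. specializes (($) x) p d d}"
        unfolding D_def
        by (rule subring_hull_subset) (use s nz in \<open>auto intro: specializes_inverse[OF free]\<close>)
      then have "specializes (($) x) p (coeff P k) (coeff P k)" for k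
        using P by blast
      then have "specializes (($) x) p (poly P b) (poly P r)"
      proof (induction P)
        case (pCons d P)
        have "specializes (($) x) p d d" "\<And>k. specializes (($) x) p (coeff P k) (coeff P k)"
          using pCons.prems[of 0] pCons.prems[of "Suc _"] by simp_all
        then show ?case
          using pCons.IH by (auto intro!: specializes_add specializes_mult s)
      qed (simp add: specializes_0)
      then show ?thesis
        using P0 specializes_0D[OF free] by simp
    qed
    then show ?thesis
      using poly_all_0_iff_0 by blast
  qed
  obtain n n' where "f * b ^ n \<in> adjoin D b" "f * b' ^ n' \<in> adjoin D b'"
    using laurent_ring_adjoin[OF D nz(2) _ f(1)] laurent_ring_adjoin[OF D nz(4) _ f(2)] base
    unfolding abc b'_def[symmetric] by blast
  moreover have "b * b' \<in> D"
  proof -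
    have "b * b' = a ^ 3 + c ^ 3"
      using nz by (simp add: b'_def)
    then show ?thesis
      using base is_subringD[OF D] by simp
  qed
  ultimately have fE: "f \<in> is_subring hull (D \<union> {b, b'})"
    by (intro laurent_intersection[OF D nz(2,4) _ trans])
  note G = is_subring_hull[of "range (gen332 x)", folded gen_ring_def]
  have mem: "a \<in> gen_ring x" "b \<in> gen_ring x" "c \<in> gen_ring x" "gen332 x Y1 \<in> gen_ring x"
    using gen_ring_closed_gen[of x X1] gen_ring_closed_gen[of x X2] gen_ring_closed_gen[of x X3]
      gen_ring_closed_gen[of x Y1] by (simp_all add: abc del: gen332.simps(4-7))
  \<comment> \<open>Multiplying x2 y1 = (x1 + x3) z by x1 x3 gives (x1 + x3) x2^3 + x1^3 + x3^3, so
    removing the first summand leaves x2 x2'.\<close>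
  have "b * (a * c * gen332 x Y1 - (a + c) * b\<^sup>2) = a ^ 3 + c ^ 3"
  proof -
    have "b * gen332 x Y1 = (a + c) * (gen332 x Y0 - 1)" "a * c * (gen332 x Y0 - 1) = b ^ 3 + a\<^sup>2 + c\<^sup>2 - a * c"
      using gen332_identities[OF alg_indep_nonzero(1)[OF free] alg_indep_nonzero(1)[OF free]
          alg_indep_nonzero(1)[OF free], unfolded abc] by blast+
    then show ?thesis by algebra
  qed
  then have b': "b' = a * c * gen332 x Y1 - (a + c) * b\<^sup>2"
    using nz by (simp add: b'_def field_simps del: gen332.simps)
  have b'G: "b' \<in> gen_ring x"
    unfolding b' by (rule mem is_subringD[OF G])+
  let ?L = "{f. \<exists>n. f * (a * c) ^ n \<in> gen_ring x}"
  have L: "is_subring ?L"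
    using mem by (intro localization_subring[OF G] is_subringD(4)[OF G])
  have GL: "g \<in> ?L" if "g \<in> gen_ring x" for g
    using that by (auto intro!: exI[of _ 0])
  have "inverse a * (a * c) ^ 1 = c" "inverse c * (a * c) ^ 1 = a"
    using nz by (simp_all add: field_simps)
  then have "inverse a * (a * c) ^ 1 \<in> gen_ring x" "inverse c * (a * c) ^ 1 \<in> gen_ring x"
    using mem by metis+
  then have "inverse a \<in> ?L" "inverse c \<in> ?L"
    by blast+
  then have "D \<subseteq> ?L"
    unfolding D_def using GL mem by (intro subring_hull_subset[OF L]) blast
  then have "D \<union> {b, b'} \<subseteq> ?L"
    using GL mem b'G by blast
  then show ?thesis
    using subring_hull_subset[OF L] fE unfolding abc by blast
qed

lemma mutate_cluster:
  assumes d: "k \<noteq> j" "j \<noteq> l" "k \<noteq> l"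
  shows "range (($) (mutate_vars k (x, B332))) =
    {(x $ j ^ nat \<bar>B332 $ j $ k\<bar> + x $ l ^ nat \<bar>B332 $ l $ k\<bar>) / x $ k, x $ j, x $ l}"
  by (simp add: range_mutate_vars[OF d] mutate_vars_markov_cyclic[OF markov_cyclic_B332 d])

lemma mutate_clusters:
  "range (($) (mutate_vars 1 (x, B332))) = {(x $ 2 ^ 3 + x $ 3 ^ 2) / x $ 1, x $ 2, x $ 3}"
  "range (($) (mutate_vars 2 (x, B332))) = {(x $ 1 ^ 3 + x $ 3 ^ 3) / x $ 2, x $ 1, x $ 3}"
  "range (($) (mutate_vars 3 (x, B332))) = {(x $ 1 ^ 2 + x $ 2 ^ 3) / x $ 3, x $ 1, x $ 2}"
  using mutate_cluster[of 1 2 3] mutate_cluster[of 2 1 3] mutate_cluster[of 3 1 2]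
  by (simp_all add: B332_def)

lemma range_vec_3: "range (($) x) = {x $ 1, x $ 2, x $ 3}"
  by (simp add: range_3_distinct[of 1 2 3])

lemma gen332_in_upper_bound: "in_upper_bound (gen332 x g) (x, B332)"
proof -
  note nz = alg_indep_nonzero(1)[OF free]
  have base: "x $ 1 \<in> laurent_ring {x $ 1, x $ 2, x $ 3}" "x $ 2 \<in> laurent_ring {x $ 1, x $ 2, x $ 3}"
    "x $ 3 \<in> laurent_ring {x $ 1, x $ 2, x $ 3}" "inverse (x $ 1) \<in> laurent_ring {x $ 1, x $ 2, x $ 3}"
    "inverse (x $ 2) \<in> laurent_ring {x $ 1, x $ 2, x $ 3}" "inverse (x $ 3) \<in> laurent_ring {x $ 1, x $ 2, x $ 3}"
    by (auto intro: laurent_ring_base)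
  have "(x $ 1 ^ 3 + x $ 3 ^ 3) / x $ 2 \<in> laurent_ring {x $ 1, x $ 2, x $ 3}"
    unfolding divide_inverse by (rule base laurent_ring_closed)+
  then have 0: "gen332 x g \<in> laurent_ring {x $ 1, x $ 2, x $ 3}"
    by (intro gen332_mem_of_mutation_2_mem nz is_subring_laurent_ring base)
  have 1: "gen332 x g \<in> laurent_ring {(x $ 2 ^ 3 + x $ 3 ^ 2) / x $ 1, x $ 2, x $ 3}"
    using gen_ring_subset_laurent_1[OF free] gen_ring_closed_gen by blast
  have 3: "gen332 x g \<in> laurent_ring {(x $ 1 ^ 2 + x $ 2 ^ 3) / x $ 3, x $ 1, x $ 2}"
  proof -
    have r: "reverse3 x $ 1 = x $ 3" "reverse3 x $ 2 = x $ 2" "reverse3 x $ 3 = x $ 1"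
      by (simp_all add: reverse3_def)
    have "{(x $ 1 ^ 2 + x $ 2 ^ 3) / x $ 3, x $ 1, x $ 2} = {(x $ 2 ^ 3 + x $ 1 ^ 2) / x $ 3, x $ 2, x $ 1}"
      by (simp add: insert_commute add.commute)
    then show ?thesis
      using gen_ring_subset_laurent_1[OF alg_indep_reverse3[OF free]] gen_ring_closed_gen[of x g]
      unfolding r gen_ring_reverse3 by auto
  qed
  let ?R = "laurent_ring {(x $ 1 ^ 3 + x $ 3 ^ 3) / x $ 2, x $ 1, x $ 3}"
  define b' where "b' = (x $ 1 ^ 3 + x $ 3 ^ 3) / x $ 2"
  have b': "x $ 1 \<in> ?R" "x $ 3 \<in> ?R" "b' \<in> ?R" "inverse (x $ 1) \<in> ?R" "inverse (x $ 3) \<in> ?R" "inverse b' \<in> ?R"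
    unfolding b'_def[symmetric] by (auto intro: laurent_ring_base)
  have "(x $ 1 ^ 3 + x $ 3 ^ 3) * inverse b' \<in> ?R"
    by (rule b' laurent_ring_closed)+
  moreover have "(x $ 1 ^ 3 + x $ 3 ^ 3) * inverse b' = x $ 2"
    using alg_indep_nonzero(2)[OF free, of 3 1 3 3] by (simp add: b'_def nz)
  ultimately have "x $ 2 \<in> ?R" by simp
  then have 2: "gen332 x g \<in> ?R"
    using b'(1-5) by (intro gen332_mem_of_mutation_2_mem nz is_subring_laurent_ring) (simp_all add: b'_def)
  have "gen332 x g \<in> laurent_ring (range (($) (mutate_vars k (x, B332))))" for k
    using exhaust_3[of k] 1 2 3 by (auto simp only: mutate_clusters)
  then show ?thesis
    using 0 by (simp add: in_upper_bound_def range_vec_3 del: gen332.simps)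
qed

lemma upper_cluster_algebra_332:
  assumes seed: "is_seed (x, B332)"
  shows "upper_cluster_algebra (x, B332) = gen_ring x"
proof
  define S where "S = {f. \<exists>v :: rat. 0 < v \<and> specializes (($) x) (\<lambda>_. 1) f v}"
  have S: "positive_set S"
    unfolding S_def by (rule positive_set_specializes[OF free])
  have "x $ i \<in> S" for i
    using specializes_var[of "($) x" "\<lambda>_. 1" i] zero_less_one unfolding S_def by blast
  then have "good_seed S (gen332 x g) (x, B332)" for g
    using gen332_in_upper_bound markov_cyclic_B332 by (simp add: good_seed_def del: gen332.simps)
  then have "gen332 x g \<in> upper_cluster_algebra (x, B332)" for g
    by (rule good_seed_in_upper_cluster_algebra[OF S])
  moreover have "is_subring (upper_cluster_algebra (x, B332))"
    unfolding upper_cluster_algebra_def is_subring_def by (auto intro: laurent_ring_closed)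
  ultimately show "gen_ring x \<subseteq> upper_cluster_algebra (x, B332)"
    unfolding gen_ring_def by (intro subring_hull_subset) auto
  show "upper_cluster_algebra (x, B332) \<subseteq> gen_ring x"
  proof
    fix f assume f: "f \<in> upper_cluster_algebra (x, B332)"
    have "mutation_equivalent (x, B332) (mutate k (x, B332))" for k
      unfolding mutation_equivalent_def by (intro r_into_equivclp seed_step.intros seed)
    then have mut: "f \<in> laurent_ring (range (($) (mutate_vars k (x, B332))))" for k
      using f unfolding upper_cluster_algebra_def clusters_def mutate_def by blast
    have "mutation_equivalent (x, B332) (x, B332)"
      by (simp add: mutation_equivalent_def)
    then have f0: "f \<in> laurent_ring {x $ 1, x $ 2, x $ 3}"
      using f unfolding upper_cluster_algebra_def clusters_def range_vec_3[symmetric] by blast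
    note f1 = mut[of 1, unfolded mutate_clusters] and f2 = mut[of 2, unfolded mutate_clusters]
      and f3 = mut[of 3, unfolded mutate_clusters]
    \<comment> \<open>The mutation at 1 now disposes of the power of x1, and the mutation at 3 of
      the power of x3.\<close>
    obtain N where "f * (x $ 1 * x $ 3) ^ N \<in> gen_ring x"
      using laurent_ring_intersection_gen_ring[OF f0 f2] by blast
    then have "x $ 1 ^ N * (x $ 3 ^ N * f) \<in> gen_ring x"
      by (simp add: power_mult_distrib ac_simps)
    moreover have "x $ 3 ^ N * f \<in> laurent_ring {(x $ 2 ^ 3 + x $ 3 ^ 2) / x $ 1, x $ 2, x $ 3}"
      by (intro laurent_ring_closed(4,7) f1 laurent_ring_base) simp
    ultimately have "x $ 3 ^ N * f \<in> gen_ring x"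
      using gen_ring_divide_1_power[OF free] by blast
    then show "f \<in> gen_ring x"
      by (rule gen_ring_divide_3_power[OF free f3])
  qed
qed

end

theorem proposition6p3p1:
  fixes x :: "'a::field_char_0 ^ 3"
  assumes "freely_generates x"
  shows "upper_cluster_algebra (x, B332) = is_subring hull (range (gen332 x)) \<and>
    {p :: (gensym, int) mpol. mpol_eval of_int (gen332 x) p = 0} = is_ideal hull relations332"
proof
  have free: "alg_indep (($) x)"
    by (rule freely_generates_alg_indep[OF assms])
  have "transpose B332 = - B332"
    by (simp add: B332_def vec_eq_iff forall_3 transpose_def)
  then have "is_seed (x, B332)"
    using assms by (simp add: is_seed_def)
  then show "upper_cluster_algebra (x, B332) = is_subring hull (range (gen332 x))"
    using upper_cluster_algebra_332[OF free] by (simp add: gen_ring_def)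
  show "{p :: (gensym, int) mpol. mpol_eval of_int (gen332 x) p = 0} = is_ideal hull relations332"
    using mpol_eval_gen332_eq_0[OF free] ideal_hull_relations332_eval[OF free] by blast
qed

end
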